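(* Let $a$ be a positive real number. For every $f\in L^{1}(\mathbb{R})\cap L^{2}(\mathbb{R})$ the inequality $$\left(\frac{a}{\pi}\right)^{1/2}\int_{\mathbb{R}}\int_{\mathbb{R}}f(x)f(x+t)e^{-a t^{2}}\,dx\,dt\leq \left(\frac{8a}{27\pi}\right)^{1/4}\|f\|_1\|f\|_2$$ holds, and the constant $\left(\frac{8a}{27\pi}\right)^{1/4}$ cannot be replaced by $\left(\frac{a}{4\pi}\right)^{1/4}$ (that is, the inequality with the latter constant fails for some $f\in L^{1}(\mathbb{R})\cap L^{2}(\mathbb{R})$).
   Context: Functions are real-valued, $f:\mathbb{R}\to\mathbb{R}$, and $\|f\|_p$ denotes the $L^p(\mathbb{R})$ norm with respect to Lebesgue measure. *)

theory Defs
  imports "HOL-Analysis.Analysis"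
begin

text \<open>
  \<open>Lp_space p\<close> and \<open>Lp_norm p\<close> are intended for \<open>0 < p\<close>. As usual, elements of the
  space are represented by functions, not by classes modulo almost-everywhere equality.
  Since \<open>0 powr p = 0\<close>, zeros of \<open>f\<close> contribute nothing to the integrals.
\<close>

definition Lp_space :: "real \<Rightarrow> (real \<Rightarrow> real) set" where
  "Lp_space p = {f. f \<in> borel_measurable lebesgue \<and> integrable lebesgue (\<lambda>x. \<bar>f x\<bar> powr p)}"

definition Lp_norm :: "real \<Rightarrow> (real \<Rightarrow> real) \<Rightarrow> real" where
  "Lp_norm p f = (\<integral>x. \<bar>f x\<bar> powr p \<partial>lebesgue) powr (1 / p)"

end

theory Submission
  imports Defs "HOL-Probability.Probability" "HOL-Real_Asymp.Real_Asymp"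
begin

text \<open>
  Let \<open>f \<ge> 0\<close>, let \<open>u\<close> be the convolution of \<open>f\<close> with \<open>exp (- a x\<^sup>2)\<close>, and let \<open>Q = \<integral> f u\<close>. Two
  applications of the Cauchy-Schwarz inequality give
  \<open>Q\<^sup>4 \<le> \<parallel>f\<parallel>\<^sub>1\<^sup>2 (\<integral> f u\<^sup>2)\<^sup>2 \<le> \<parallel>f\<parallel>\<^sub>1\<^sup>2 \<parallel>f\<parallel>\<^sub>2\<^sup>2 \<integral> u\<^sup>4\<close>,
  so a bound \<open>\<integral> u\<^sup>4 \<le> C Q\<^sup>2\<close> suffices. Since \<open>Q\<close> is, up to a constant, the square of the
  \<open>L\<^sup>2\<close> norm of the convolution of \<open>f\<close> with \<open>exp (- 2 a x\<^sup>2)\<close>, this is the sharp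
  \<open>L\<^sup>2\<close>-\<open>L\<^sup>4\<close> bound for the heat semigroup. A change of weight turns it into Nelson's hypercontractive
  inequality with \<open>\<rho>\<^sup>2 = 1 / 3\<close>, which is the central limit of the same inequality on the cube
  \<open>{1, -1}\<^sup>n\<close>; there it follows by induction on \<open>n\<close> from the two-point inequality
  \<open>x\<^sup>4 + 6 \<rho>\<^sup>2 x\<^sup>2 y\<^sup>2 + \<rho>\<^sup>4 y\<^sup>4 \<le> (x\<^sup>2 + y\<^sup>2)\<^sup>2\<close>.
\<close>

section \<open>Hypercontractivity on the discrete cube\<close>

text \<open>The obstacle is the passage from the cube to the line, since the noise of a general
  function of the normalised sum is not explicit. It is needed only for a mixture \<open>h\<close>
  of the bumps \<open>exp (- (s - 2 * y)\<^sup>2 / 4)\<close>. Each bump is a Fourier integral of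
  cosines, on which noise is an explicit product, so the limit comes with an error uniform over the
  cube and over y. The weight \<open>exp (y\<^sup>2 / 2)\<close> is the one for which
  \<open>h\<close> times the square root of the normal density, and \<open>H\<close> times its
  fourth root, are Gaussian convolutions of f up to scaling. The value 1/3 is the largest \<rho>^2
  with 6 \<rho>^2 \<le> 2, as the cross term of the two-point inequality demands. All this is done
  for a = 1/4; a dilation restores a. With C = \<open>smoothing_const\<close> the final constant is
  the square root of (a / pi) C / (2 sqrt a), and C^2 = 32 pi / 27 produces the 8/27. For f = exp (-
  2 a x^2) the bound on the integral of u^4 is an equality and only the Cauchy-Schwarz steps are
  strict; this Gaussian is the starting point of the counterexample.\<close>

fun cube_mean :: "nat \<Rightarrow> (real list \<Rightarrow> real) \<Rightarrow> real" where
  "cube_mean 0 h = h []"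
| "cube_mean (Suc n) h = (cube_mean n (\<lambda>x. h (1 # x)) + cube_mean n (\<lambda>x. h (-1 # x))) / 2"

text \<open>
  For \<open>x \<in> {1, -1}\<^sup>n\<close>, \<open>noise \<rho> h x\<close> is the expectation of \<open>h y\<close> when the coordinates of
  \<open>y \<in> {1, -1}\<^sup>n\<close> are independent, each with mean \<open>\<rho>\<close> times that of \<open>x\<close>.
\<close>

fun noise :: "real \<Rightarrow> (real list \<Rightarrow> real) \<Rightarrow> real list \<Rightarrow> real" where
  "noise \<rho> h [] = h []"
| "noise \<rho> h (e # x) =
     (1 + \<rho> * e) / 2 * noise \<rho> (\<lambda>y. h (1 # y)) x + (1 - \<rho> * e) / 2 * noise \<rho> (\<lambda>y. h (-1 # y)) x"

lemma cube_mean_add: "cube_mean n (\<lambda>x. g x + h x) = cube_mean n g + cube_mean n h"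
  by (induction n arbitrary: g h) (simp_all add: field_simps)

lemma cube_mean_cmult: "cube_mean n (\<lambda>x. c * h x) = c * cube_mean n h"
  by (induction n arbitrary: h) (simp_all add: field_simps)

lemma cube_mean_const: "cube_mean n (\<lambda>x. c) = c"
  by (induction n) simp_all

definition cube :: "nat \<Rightarrow> real list set" where
  "cube n = {x. length x = n \<and> set x \<subseteq> {1, -1}}"

lemma cube_mean_mono:
  assumes "\<And>x. x \<in> cube n \<Longrightarrow> g x \<le> h x"
  shows "cube_mean n g \<le> cube_mean n h"
  using assms
proof (induction n arbitrary: g h)
  case 0 then show ?case by (simp add: cube_def)
next
  case (Suc n)
  have "cube_mean n (\<lambda>x. g (e # x)) \<le> cube_mean n (\<lambda>x. h (e # x))" if "e \<in> {1, -1}" for e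
    using that by (intro Suc.IH Suc.prems) (auto simp: cube_def)
  from this[of 1] this[of "-1"] show ?case by simp
qed

lemma cube_mean_nonneg: "(\<And>x. 0 \<le> h x) \<Longrightarrow> 0 \<le> cube_mean n h"
  using cube_mean_mono[of n "\<lambda>x. 0" h] by (simp add: cube_mean_const)

text \<open>The mean of (s g + t h)^2 is a nonnegative quadratic form s^2 a + 2 s t b + t^2 c. Its
  value at s = - b, t = a is a (a c - b^2), which settles the case a > 0.\<close>

lemma cube_mean_Cauchy_Schwarz:
  "(cube_mean n (\<lambda>x. g x * h x))\<^sup>2 \<le> cube_mean n (\<lambda>x. (g x)\<^sup>2) * cube_mean n (\<lambda>x. (h x)\<^sup>2)"
proof -
  let ?a = "cube_mean n (\<lambda>x. (g x)\<^sup>2)" and ?b = "cube_mean n (\<lambda>x. g x * h x)"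
    and ?c = "cube_mean n (\<lambda>x. (h x)\<^sup>2)"
  have expansion: "0 \<le> s\<^sup>2 * ?a + 2 * s * t * ?b + t\<^sup>2 * ?c" for s t
  proof -
    have "0 \<le> cube_mean n (\<lambda>x. (s * g x + t * h x)\<^sup>2)" by (rule cube_mean_nonneg) simp
    also have "(\<lambda>x. (s * g x + t * h x)\<^sup>2) =
        (\<lambda>x. (s\<^sup>2 * (g x)\<^sup>2 + (2 * s * t) * (g x * h x)) + t\<^sup>2 * (h x)\<^sup>2)"
      by (simp add: power2_eq_square algebra_simps)
    also have "cube_mean n \<dots> = s\<^sup>2 * ?a + 2 * s * t * ?b + t\<^sup>2 * ?c"
      by (simp only: cube_mean_add cube_mean_cmult)
    finally show ?thesis .
  qed
  have a: "0 \<le> ?a" using expansion[of 1 0] by simp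
  show ?thesis
  proof (cases "?a = 0")
    case True
    have "?b = 0"
    proof (rule ccontr)
      assume "?b \<noteq> 0"
      \<comment> \<open>For a = 0 the form is linear in s; this s makes its value at t = 1 equal to
        - 1.\<close>
      have "0 \<le> 2 * (- (?c + 1) / (2 * ?b)) * ?b + ?c"
        using expansion[of "- (?c + 1) / (2 * ?b)" 1] True by simp
      with \<open>?b \<noteq> 0\<close> show False by (simp add: field_simps)
    qed
    then show ?thesis using True by simp
  next
    case False
    with a have "?a > 0" by simp
    have "0 \<le> ?a * (?a * ?c - ?b\<^sup>2)"
      using expansion[of "- ?b" "?a"] by (simp add: power2_eq_square algebra_simps)
    with \<open>?a > 0\<close> have "0 \<le> ?a * ?c - ?b\<^sup>2" by (simp add: zero_le_mult_iff)
    then show ?thesis by simp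
  qed
qed

lemma noise_add: "noise \<rho> (\<lambda>y. g y + h y) x = noise \<rho> g x + noise \<rho> h x"
  by (induction x arbitrary: g h) (simp_all add: algebra_simps add_divide_distrib)

lemma noise_cmult: "noise \<rho> (\<lambda>y. c * h y) x = c * noise \<rho> h x"
  by (induction x arbitrary: h) (simp_all add: algebra_simps)

text \<open>Write h (e # x) = A x + e B x. Noise turns this into T A + \<rho> e T B, where T is
  noise in the remaining coordinates, and averaging the fourth power over e = 1, -1 removes the odd
  powers. The induction hypothesis bounds the two pure terms, Cauchy-Schwarz in the remaining
  coordinates bounds the mixed one, and 6 \<rho>^2 \<le> 2 fits everything under (P + Q)^2, where P
  + Q is the mean of h^2.\<close>

theorem hypercontractive_2_4:
  assumes "\<rho>\<^sup>2 \<le> 1 / 3"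
  shows "cube_mean n (\<lambda>x. (noise \<rho> h x) ^ 4) \<le> (cube_mean n (\<lambda>x. (h x)\<^sup>2))\<^sup>2"
proof (induction n arbitrary: h)
  case 0 then show ?case by simp
next
  case (Suc n)
  define A B where "A = (\<lambda>x. (1/2) * (h (1 # x) + h (-1 # x)))"
    and "B = (\<lambda>x. (1/2) * (h (1 # x) + (-1) * h (-1 # x)))"
  have A: "noise \<rho> A x = (noise \<rho> (\<lambda>y. h (1 # y)) x + noise \<rho> (\<lambda>y. h (-1 # y)) x) / 2"
   and B: "noise \<rho> B x = (noise \<rho> (\<lambda>y. h (1 # y)) x - noise \<rho> (\<lambda>y. h (-1 # y)) x) / 2" for x
    unfolding A_def B_def by (simp_all only: noise_add noise_cmult) simp_all
  define p q r where "p = cube_mean n (\<lambda>x. (noise \<rho> A x) ^ 4)"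
    and "q = cube_mean n (\<lambda>x. (noise \<rho> B x) ^ 4)"
    and "r = cube_mean n (\<lambda>x. (noise \<rho> A x)\<^sup>2 * (noise \<rho> B x)\<^sup>2)"
  define P Q where "P = cube_mean n (\<lambda>x. (A x)\<^sup>2)" and "Q = cube_mean n (\<lambda>x. (B x)\<^sup>2)"
  have "0 \<le> P" "0 \<le> Q" "0 \<le> q"
    unfolding P_def Q_def q_def by (simp_all add: cube_mean_nonneg)
  have "p \<le> P\<^sup>2" "q \<le> Q\<^sup>2" unfolding p_def q_def P_def Q_def by (rule Suc.IH)+
  have "r\<^sup>2 \<le> p * q"
    using cube_mean_Cauchy_Schwarz[of n "\<lambda>x. (noise \<rho> A x)\<^sup>2" "\<lambda>x. (noise \<rho> B x)\<^sup>2"]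
    unfolding p_def q_def r_def by (simp flip: power_mult)
  also have "\<dots> \<le> P\<^sup>2 * Q\<^sup>2"
    using \<open>p \<le> P\<^sup>2\<close> \<open>q \<le> Q\<^sup>2\<close> \<open>0 \<le> q\<close> by (intro mult_mono) auto
  finally have "r \<le> P * Q"
    using \<open>0 \<le> P\<close> \<open>0 \<le> Q\<close> by (metis power_mult_distrib power2_le_imp_le mult_nonneg_nonneg)
  have "cube_mean (Suc n) (\<lambda>x. (noise \<rho> h x) ^ 4) =
      (1/2) * (cube_mean n (\<lambda>x. (noise \<rho> A x + \<rho> * noise \<rho> B x) ^ 4)
        + cube_mean n (\<lambda>x. (noise \<rho> A x - \<rho> * noise \<rho> B x) ^ 4))"
    by (simp add: A B field_simps)
  also have "\<dots> = cube_mean n (\<lambda>x. ((noise \<rho> A x) ^ 4 + (6 * \<rho>\<^sup>2) * ((noise \<rho> A x)\<^sup>2 * (noise \<rho> B x)\<^sup>2))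
      + \<rho> ^ 4 * (noise \<rho> B x) ^ 4)"
    unfolding cube_mean_add[symmetric] cube_mean_cmult[symmetric]
    by (simp add: power4_eq_xxxx power2_eq_square algebra_simps)
  also have "\<dots> = p + 6 * \<rho>\<^sup>2 * r + \<rho> ^ 4 * q"
    unfolding p_def q_def r_def by (simp only: cube_mean_add cube_mean_cmult)
  also have "\<dots> \<le> P\<^sup>2 + 2 * (P * Q) + 1 * Q\<^sup>2"
  proof -
    have "6 * \<rho>\<^sup>2 * r \<le> 6 * \<rho>\<^sup>2 * (P * Q)"
      using \<open>r \<le> P * Q\<close> by (intro mult_left_mono) auto
    also have "\<dots> \<le> 2 * (P * Q)"
      using assms \<open>0 \<le> P\<close> \<open>0 \<le> Q\<close> by (intro mult_right_mono) auto
    finally have 1: "6 * \<rho>\<^sup>2 * r \<le> 2 * (P * Q)" .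
    have "\<rho> ^ 4 = \<rho>\<^sup>2 * \<rho>\<^sup>2" by (simp add: power4_eq_xxxx power2_eq_square)
    also have "\<dots> \<le> 1 * 1" using assms by (intro mult_mono) auto
    finally have "\<rho> ^ 4 * q \<le> 1 * Q\<^sup>2"
      using \<open>q \<le> Q\<^sup>2\<close> \<open>0 \<le> q\<close> by (intro mult_mono) auto
    with 1 \<open>p \<le> P\<^sup>2\<close> show ?thesis by linarith
  qed
  also have "\<dots> = (P + Q)\<^sup>2" by (simp add: power2_eq_square algebra_simps)
  also have "(P + Q)\<^sup>2 = (cube_mean (Suc n) (\<lambda>x. (h x)\<^sup>2))\<^sup>2"
  proof -
    have "P + Q = cube_mean n (\<lambda>x. (A x)\<^sup>2 + (B x)\<^sup>2)" unfolding P_def Q_def by (simp only: cube_mean_add)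
    also have "(\<lambda>x. (A x)\<^sup>2 + (B x)\<^sup>2) = (\<lambda>x. (1/2) * ((h (1 # x))\<^sup>2 + (h (-1 # x))\<^sup>2))"
      by (rule ext) (simp add: A_def B_def power2_eq_square field_simps)
    also have "cube_mean n \<dots> = cube_mean (Suc n) (\<lambda>x. (h x)\<^sup>2)"
      unfolding cube_mean_cmult cube_mean_add by simp
    finally show ?thesis by (simp only:)
  qed
  finally show ?case .
qed

section \<open>Passage to the Gaussian limit\<close>

fun walk :: "nat \<Rightarrow> real pmf" where
  "walk 0 = return_pmf 0"
| "walk (Suc n) = bind_pmf (bernoulli_pmf (1/2)) (\<lambda>b. map_pmf (\<lambda>s. (if b then 1 else -1) + s) (walk n))"

lemma finite_set_walk: "finite (set_pmf (walk n))"
  by (induction n) auto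

lemma expectation_walk_Suc:
  fixes F :: "real \<Rightarrow> 'a::{banach, second_countable_topology}"
  shows "measure_pmf.expectation (walk (Suc n)) F =
    (1/2) *\<^sub>R measure_pmf.expectation (walk n) (\<lambda>s. F (1 + s)) +
    (1/2) *\<^sub>R measure_pmf.expectation (walk n) (\<lambda>s. F (-1 + s))"
  unfolding walk.simps
  by (subst pmf_expectation_bind[where A = UNIV])
     (auto simp: UNIV_bool finite_set_walk integral_map_pmf)

text \<open>Turns averages over the cube into expectations under a probability law, which makes
  characteristic functions available.\<close>

lemma cube_mean_sum_list:
  "cube_mean n (\<lambda>x. F (sum_list x)) = measure_pmf.expectation (walk n) F"
proof (induction n arbitrary: F)
  case (Suc n)
  show ?case
    using Suc.IH[of "\<lambda>s. F (1 + s)"] Suc.IH[of "\<lambda>s. F (- 1 + s)"]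
    by (simp add: expectation_walk_Suc del: walk.simps)
qed simp

lemma expectation_walk_cis: "measure_pmf.expectation (walk n) (\<lambda>s. cis (t * s)) = of_real (cos t ^ n)"
proof (induction n)
  case 0 then show ?case by simp
next
  case (Suc n)
  have "cis (t * (1 + s)) = cis t * cis (t * s)" "cis (t * (- 1 + s)) = cis (- t) * cis (t * s)" for s
    by (simp_all add: cis_mult algebra_simps)
  then have "measure_pmf.expectation (walk (Suc n)) (\<lambda>s. cis (t * s)) =
     (1/2) *\<^sub>R (cis t * of_real (cos t ^ n)) + (1/2) *\<^sub>R (cis (-t) * of_real (cos t ^ n))"
    unfolding expectation_walk_Suc by (simp add: Suc)
  then show ?case by (simp add: complex_eq_iff)
qed

text \<open>For n = 0 the quotient is 0 / 0 = 0, so the law is a point mass at 0. It is thus a real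
  distribution for every n, as the continuity theorem asks.\<close>

definition scaled_walk :: "nat \<Rightarrow> real measure" where
  "scaled_walk n = distr (measure_pmf (walk n)) borel (\<lambda>s. s / sqrt n)"

lemma real_distribution_scaled_walk: "real_distribution (scaled_walk n)"
  unfolding scaled_walk_def by (intro prob_space.real_distribution_distr measure_pmf.prob_space_axioms) simp

lemma integral_scaled_walk:
  fixes F :: "real \<Rightarrow> real"
  assumes "F \<in> borel_measurable borel"
  shows "integral\<^sup>L (scaled_walk n) F = cube_mean n (\<lambda>x. F (sum_list x / sqrt n))"
  unfolding scaled_walk_def
  using assms by (subst integral_distr) (simp_all add: cube_mean_sum_list[of n "\<lambda>s. F (s / sqrt n)"])

lemma char_scaled_walk: "char (scaled_walk n) t = of_real (cos (t / sqrt n) ^ n)"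
proof -
  have "char (scaled_walk n) t = (CLINT s|measure_pmf (walk n). iexp (t * (s / sqrt n)))"
    unfolding scaled_walk_def char_def by (subst integral_distr) auto
  also have "\<dots> = (CLINT s|measure_pmf (walk n). cis ((t / sqrt n) * s))"
    by (simp add: cis_conv_exp mult.commute)
  finally show ?thesis by (simp only: expectation_walk_cis)
qed

text \<open>Levy's continuity theorem reduces this to cos (t / sqrt n) ^ n tending to exp (- t^2 /
  2). The test functions are bounded and continuous because the convergence is weak convergence of
  laws.\<close>

lemma cube_mean_tendsto_normal:
  fixes F :: "real \<Rightarrow> real"
  assumes "\<And>x. isCont F x" "\<And>x. \<bar>F x\<bar> \<le> B"
  shows "(\<lambda>n. cube_mean n (\<lambda>x. F (sum_list x / sqrt n)))
    \<longlonglongrightarrow> (\<integral>x. std_normal_density x * F x \<partial>lborel)"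
proof -
  have [measurable]: "F \<in> borel_measurable borel"
    using assms(1) by (intro borel_measurable_continuous_onI continuous_at_imp_continuous_on) auto
  have "(\<lambda>n. cos (t / sqrt (real n)) ^ n) \<longlonglongrightarrow> exp (- (t\<^sup>2) / 2)" for t :: real
    by (real_asymp simp: power2_eq_square)
  then have "(\<lambda>n. char (scaled_walk n) t) \<longlonglongrightarrow> char std_normal_distribution t" for t
    unfolding char_scaled_walk char_std_normal_distribution by (intro tendsto_of_real)
  then have "weak_conv_m scaled_walk std_normal_distribution"
    by (intro levy_continuity real_distribution_scaled_walk real_dist_normal_dist)
  then have "(\<lambda>n. integral\<^sup>L (scaled_walk n) F) \<longlonglongrightarrow> integral\<^sup>L std_normal_distribution F"
    using assms
    by (intro weak_conv_imp_integral_bdd_continuous_conv[where B = B] real_distribution_scaled_walk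
          real_dist_normal_dist) auto
  also have "integral\<^sup>L std_normal_distribution F = (\<integral>x. std_normal_density x * F x \<partial>lborel)"
    by (subst integral_density) auto
  finally show ?thesis by (simp add: integral_scaled_walk)
qed

section \<open>Noise acting on characters\<close>

lemma noise_cis:
  "noise \<rho> (\<lambda>y. Re (w * cis (\<tau> * sum_list y))) x
    = Re (w * (\<Prod>e\<leftarrow>x. Complex (cos \<tau>) (\<rho> * e * sin \<tau>)))"
proof (induction x arbitrary: w)
  case Nil then show ?case by simp
next
  case (Cons e x)
  \<comment> \<open>The factor cis (\<tau>) or cis (- \<tau>) of the coordinate split off is
    absorbed into w, so the induction runs over all complex w. Since \<open>noise\<close> takes real
    functions, the character enters through its real part.\<close>
  have 1: "w * cis (\<tau> * sum_list (1 # y)) = (w * cis \<tau>) * cis (\<tau> * sum_list y)"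
   and 2: "w * cis (\<tau> * sum_list (-1 # y)) = (w * cis (-\<tau>)) * cis (\<tau> * sum_list y)" for y
    by (simp_all add: mult.assoc cis_mult algebra_simps)
  have 3: "p * Re (w * c * P) + q * Re (w * d * P) = Re ((of_real p * c + of_real q * d) * (w * P))"
    for p q :: real and c d P
  proof -
    have "p * Re (w * c * P) + q * Re (w * d * P) = Re (of_real p * (w * c * P) + of_real q * (w * d * P))"
      by simp
    also have "of_real p * (w * c * P) + of_real q * (w * d * P) = (of_real p * c + of_real q * d) * (w * P)"
      by (simp only: ring_distribs mult_ac)
    finally show ?thesis .
  qed
  have "noise \<rho> (\<lambda>y. Re (w * cis (\<tau> * sum_list y))) (e # x) =
     Re ((of_real ((1 + \<rho> * e) / 2) * cis \<tau> + of_real ((1 - \<rho> * e) / 2) * cis (- \<tau>)) *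
       (w * (\<Prod>e\<leftarrow>x. Complex (cos \<tau>) (\<rho> * e * sin \<tau>))))"
    unfolding noise.simps 1 2 Cons.IH by (rule 3)
  also have "of_real ((1 + \<rho> * e) / 2) * cis \<tau> + of_real ((1 - \<rho> * e) / 2) * cis (- \<tau>)
      = Complex (cos \<tau>) (\<rho> * e * sin \<tau>)"
    by (simp add: complex_eq_iff field_simps)
  finally show ?case by (simp add: mult_ac)
qed

lemma norm_prod_list_le_1:
  fixes a :: "'b \<Rightarrow> 'a::real_normed_field"
  assumes "\<And>e. e \<in> set x \<Longrightarrow> norm (a e) \<le> 1"
  shows "norm (\<Prod>e\<leftarrow>x. a e) \<le> 1"
  using assms by (induction x) (auto simp: norm_mult intro: mult_le_one)

lemma norm_prod_list_diff_le:
  fixes a b :: "'b \<Rightarrow> 'a::real_normed_field"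
  assumes "\<And>e. e \<in> set x \<Longrightarrow> norm (a e) \<le> 1" "\<And>e. e \<in> set x \<Longrightarrow> norm (b e) \<le> 1"
    and "\<And>e. e \<in> set x \<Longrightarrow> norm (a e - b e) \<le> d"
  shows "norm ((\<Prod>e\<leftarrow>x. a e) - (\<Prod>e\<leftarrow>x. b e)) \<le> real (length x) * d"
  using assms
proof (induction x)
  case Nil then show ?case by simp
next
  case (Cons e x)
  let ?A = "\<Prod>e\<leftarrow>x. a e" and ?B = "\<Prod>e\<leftarrow>x. b e"
  have "norm (a e * ?A - b e * ?B) = norm ((a e - b e) * ?A + b e * (?A - ?B))"
    by (simp add: algebra_simps)
  also have "\<dots> \<le> norm (a e - b e) * norm ?A + norm (b e) * norm (?A - ?B)"
    by (intro norm_triangle_le add_mono) (simp_all add: norm_mult)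
  also have "\<dots> \<le> d * 1 + 1 * (real (length x) * d)"
  proof (intro add_mono mult_mono)
    show "norm ?A \<le> 1" using Cons.prems(1) by (intro norm_prod_list_le_1) auto
    show "norm (?A - ?B) \<le> real (length x) * d" using Cons by auto
    show "0 \<le> d" using Cons.prems(3)[of e] by (auto intro: order_trans[OF norm_ge_zero])
  qed (use Cons.prems in auto)
  finally show ?case by (simp add: algebra_simps)
qed

text \<open>
  On \<open>cis (\<tau> * sum_list y)\<close> with \<open>\<tau> = \<xi> / sqrt n\<close>, the noise operator acts through one factor
  \<open>cos \<tau> + \<i> \<rho> e sin \<tau>\<close> per coordinate \<open>e\<close>, the Gaussian one through
  \<open>exp (\<i> \<rho> e \<tau> - (1 - \<rho>\<^sup>2) \<tau>\<^sup>2 / 2)\<close>; telescoping the product costs \<open>n\<close> times the difference of the factors.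
\<close>

definition noise_error :: "real \<Rightarrow> nat \<Rightarrow> real \<Rightarrow> real" where
  "noise_error \<rho> n \<xi> = n * cmod (Complex (cos (\<xi> / sqrt n)) (\<rho> * sin (\<xi> / sqrt n))
     - exp (- (1 - \<rho>\<^sup>2) * (\<xi> / sqrt n)\<^sup>2 / 2) * cis (\<rho> * (\<xi> / sqrt n)))"

lemma noise_error_tendsto_0: "(\<lambda>n. noise_error \<rho> n \<xi>) \<longlonglongrightarrow> 0"
proof -
  let ?t = "\<lambda>n. \<xi> / sqrt (real n)"
  let ?e = "\<lambda>n. exp (- (1 - \<rho>\<^sup>2) * (?t n)\<^sup>2 / 2)"
  have cos: "(\<lambda>n. n * (1 - cos (c / sqrt (real n)))) \<longlonglongrightarrow> c\<^sup>2 / 2" for c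
    by (cases "c = 0") (simp, real_asymp simp: power2_eq_square)
  have sin: "(\<lambda>n. n * (c / sqrt (real n) - sin (c / sqrt (real n)))) \<longlonglongrightarrow> 0" for c
    by (cases "c = 0") (simp, real_asymp)
  have exp: "(\<lambda>n. n * (1 - exp (- c / real n))) \<longlonglongrightarrow> c" for c
    by (cases "c = 0") (simp, real_asymp)
  have e: "?e n = exp (- ((1 - \<rho>\<^sup>2) * \<xi>\<^sup>2 / 2) / real n)" for n
    by (cases "n = 0") (simp_all add: power_divide field_simps)
  have "(\<lambda>n. exp (- c / real n)) \<longlonglongrightarrow> 1" for c by real_asymp
  then have e1: "?e \<longlonglongrightarrow> 1" unfolding e .
  have s0: "(\<lambda>n. sin (c / sqrt (real n))) \<longlonglongrightarrow> 0" for c by real_asymp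
  \<comment> \<open>Real part: with E the exponential and \<tau> = \<xi> / sqrt n, cos \<tau> - E
    cos (\<rho> \<tau>) = - (1 - cos \<tau>) + (1 - E) + E (1 - cos (\<rho> \<tau>)). The
    second-order coefficients - 1/2, (1 - \<rho>^2) / 2 and \<rho>^2 / 2 cancel, which is what fixes
    the damping (1 - \<rho>^2) / 2.\<close>
  have "(\<lambda>n. - (n * (1 - cos (\<xi> / sqrt (real n)))) + n * (1 - ?e n)
      + ?e n * (n * (1 - cos ((\<rho> * \<xi>) / sqrt (real n)))))
      \<longlonglongrightarrow> - (\<xi>\<^sup>2 / 2) + (1 - \<rho>\<^sup>2) * \<xi>\<^sup>2 / 2 + 1 * ((\<rho> * \<xi>)\<^sup>2 / 2)"
    unfolding e by (intro tendsto_intros cos exp e1[unfolded e])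
  also have "- (\<xi>\<^sup>2 / 2) + (1 - \<rho>\<^sup>2) * \<xi>\<^sup>2 / 2 + 1 * ((\<rho> * \<xi>)\<^sup>2 / 2) = 0"
    by (simp add: field_simps power2_eq_square)
  finally have "(\<lambda>n. real n * (cos (\<xi> / sqrt n) - exp (- (1 - \<rho>\<^sup>2) * (\<xi> / sqrt n)\<^sup>2 / 2) * cos (\<rho> * (\<xi> / sqrt n)))) \<longlonglongrightarrow> 0"
    by (rule Lim_transform_eventually) (intro always_eventually allI, simp add: algebra_simps)
  moreover
  \<comment> \<open>Imaginary part: adding and subtracting \<rho> \<tau> cancels the first-order
    terms. The cubic remainders survive only at order n^(-1/2), and n (1 - E) stays bounded while
    its sine factor tends to 0.\<close>
  have "(\<lambda>n. \<rho> * - (n * (\<xi> / sqrt (real n) - sin (\<xi> / sqrt (real n))))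
      + n * ((\<rho> * \<xi>) / sqrt (real n) - sin ((\<rho> * \<xi>) / sqrt (real n)))
      + (n * (1 - ?e n)) * sin ((\<rho> * \<xi>) / sqrt (real n)))
      \<longlonglongrightarrow> \<rho> * - 0 + 0 + ((1 - \<rho>\<^sup>2) * \<xi>\<^sup>2 / 2) * 0"
    unfolding e by (intro tendsto_intros sin exp s0)
  then have "(\<lambda>n. \<rho> * - (n * (\<xi> / sqrt (real n) - sin (\<xi> / sqrt (real n))))
      + n * ((\<rho> * \<xi>) / sqrt (real n) - sin ((\<rho> * \<xi>) / sqrt (real n)))
      + (n * (1 - ?e n)) * sin ((\<rho> * \<xi>) / sqrt (real n))) \<longlonglongrightarrow> 0" by simp
  then have "(\<lambda>n. real n * (\<rho> * sin (\<xi> / sqrt n) - exp (- (1 - \<rho>\<^sup>2) * (\<xi> / sqrt n)\<^sup>2 / 2) * sin (\<rho> * (\<xi> / sqrt n)))) \<longlonglongrightarrow> 0"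
    by (rule Lim_transform_eventually) (intro always_eventually allI, simp add: algebra_simps)
  ultimately have "(\<lambda>n. cmod (Complex (real n * (cos (\<xi> / sqrt n) - exp (- (1 - \<rho>\<^sup>2) * (\<xi> / sqrt n)\<^sup>2 / 2) * cos (\<rho> * (\<xi> / sqrt n))))
      (real n * (\<rho> * sin (\<xi> / sqrt n) - exp (- (1 - \<rho>\<^sup>2) * (\<xi> / sqrt n)\<^sup>2 / 2) * sin (\<rho> * (\<xi> / sqrt n)))))) \<longlonglongrightarrow> cmod (Complex 0 0)"
    by (intro tendsto_norm tendsto_Complex)
  also have "cmod (Complex 0 0) = 0" by (simp add: zero_complex.code)
  also have "(\<lambda>n. cmod (Complex (real n * (cos (\<xi> / sqrt n) - exp (- (1 - \<rho>\<^sup>2) * (\<xi> / sqrt n)\<^sup>2 / 2) * cos (\<rho> * (\<xi> / sqrt n))))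
      (real n * (\<rho> * sin (\<xi> / sqrt n) - exp (- (1 - \<rho>\<^sup>2) * (\<xi> / sqrt n)\<^sup>2 / 2) * sin (\<rho> * (\<xi> / sqrt n)))))) = (\<lambda>n. noise_error \<rho> n \<xi>)"
  proof
    fix n
    have "Complex (real n * (cos (\<xi> / sqrt n) - exp (- (1 - \<rho>\<^sup>2) * (\<xi> / sqrt n)\<^sup>2 / 2) * cos (\<rho> * (\<xi> / sqrt n))))
      (real n * (\<rho> * sin (\<xi> / sqrt n) - exp (- (1 - \<rho>\<^sup>2) * (\<xi> / sqrt n)\<^sup>2 / 2) * sin (\<rho> * (\<xi> / sqrt n)))) =
      of_real n * (Complex (cos (\<xi> / sqrt n)) (\<rho> * sin (\<xi> / sqrt n))
     - exp (- (1 - \<rho>\<^sup>2) * (\<xi> / sqrt n)\<^sup>2 / 2) * cis (\<rho> * (\<xi> / sqrt n)))"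
      unfolding complex_eq_iff by (simp add: Re_exp Im_exp flip: exp_of_real)
    then show "cmod (Complex (real n * (cos (\<xi> / sqrt n) - exp (- (1 - \<rho>\<^sup>2) * (\<xi> / sqrt n)\<^sup>2 / 2) * cos (\<rho> * (\<xi> / sqrt n))))
      (real n * (\<rho> * sin (\<xi> / sqrt n) - exp (- (1 - \<rho>\<^sup>2) * (\<xi> / sqrt n)\<^sup>2 / 2) * sin (\<rho> * (\<xi> / sqrt n))))) = noise_error \<rho> n \<xi>"
      by (simp add: noise_error_def norm_mult)
  qed
  finally show ?thesis .
qed

text \<open>The bound depends on neither x nor z, so it is uniform over the cube and over
  translations. The telescoping estimate vanishes only pointwise in \<xi>; the cap 2, from two
  products of norm at most 1, supplies the majorant for integrating over \<xi>.\<close>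

lemma noise_cos:
  assumes "0 \<le> \<rho>" "\<rho> \<le> 1" "0 < n" "x \<in> cube n"
  shows "\<bar>noise \<rho> (\<lambda>y. cos (\<xi> * (sum_list y / sqrt n - z))) x
     - exp (- (1 - \<rho>\<^sup>2) * \<xi>\<^sup>2 / 2) * cos (\<xi> * (\<rho> * (sum_list x / sqrt n) - z))\<bar>
     \<le> min 2 (noise_error \<rho> n \<xi>)"
proof -
  define \<tau> where "\<tau> = \<xi> / sqrt n"
  define a where "a = (\<lambda>e. Complex (cos \<tau>) (\<rho> * e * sin \<tau>))"
  define b where "b = (\<lambda>e::real. of_real (exp (- (1 - \<rho>\<^sup>2) * \<tau>\<^sup>2 / 2)) * cis (\<rho> * \<tau> * e))"
  have e: "e = 1 \<or> e = -1" if "e \<in> set x" for e using that assms by (auto simp: cube_def)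
  have "\<rho>\<^sup>2 \<le> 1" using assms by (simp add: power_le_one)
  have na: "norm (a e) \<le> 1" if "e \<in> set x" for e
  proof -
    have "(cos \<tau>)\<^sup>2 + \<rho>\<^sup>2 * (sin \<tau>)\<^sup>2 \<le> (cos \<tau>)\<^sup>2 + 1 * (sin \<tau>)\<^sup>2"
      using \<open>\<rho>\<^sup>2 \<le> 1\<close> by (intro add_left_mono mult_right_mono) auto
    with e[OF that] show ?thesis by (auto simp: a_def cmod_def power_mult_distrib)
  qed
  have nb: "norm (b e) \<le> 1" for e
    using \<open>\<rho>\<^sup>2 \<le> 1\<close> by (simp add: b_def norm_mult mult_nonpos_nonneg)
  have "norm (a e - b e) \<le> norm (a 1 - b 1)" if "e \<in> set x" for e
  proof -
    \<comment> \<open>Changing the sign of a coordinate conjugates both factors, so one error value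
      serves both signs.\<close>
    have "a (-1) - b (-1) = cnj (a 1 - b 1)" by (simp add: a_def b_def complex_eq_iff)
    then have "norm (a (-1) - b (-1)) = norm (a 1 - b 1)" by (simp only: complex_mod_cnj)
    with e[OF that] show ?thesis by auto
  qed
  from norm_prod_list_diff_le[of x a b, OF na nb this]
  have "norm ((\<Prod>e\<leftarrow>x. a e) - (\<Prod>e\<leftarrow>x. b e)) \<le> length x * norm (a 1 - b 1)" by simp
  also have "\<dots> = noise_error \<rho> n \<xi>"
    using assms by (simp add: a_def b_def noise_error_def \<tau>_def cube_def)
  finally have le1: "norm ((\<Prod>e\<leftarrow>x. a e) - (\<Prod>e\<leftarrow>x. b e)) \<le> noise_error \<rho> n \<xi>" .
  have le2: "norm ((\<Prod>e\<leftarrow>x. a e) - (\<Prod>e\<leftarrow>x. b e)) \<le> 2"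
    using norm_triangle_ineq4[of "\<Prod>e\<leftarrow>x. a e" "\<Prod>e\<leftarrow>x. b e"]
      norm_prod_list_le_1[of x a, OF na] norm_prod_list_le_1[of x b] nb by simp
  have prod_b: "(\<Prod>e\<leftarrow>y. b e) = of_real (exp (- (1 - \<rho>\<^sup>2) * \<tau>\<^sup>2 / 2) ^ length y) * cis (\<rho> * \<tau> * sum_list y)" for y
    by (induction y) (simp_all add: b_def cis_mult algebra_simps flip: cis_mult)
  have "exp (- (1 - \<rho>\<^sup>2) * \<tau>\<^sup>2 / 2) ^ length x = exp (- (1 - \<rho>\<^sup>2) * \<xi>\<^sup>2 / 2)"
    using assms by (simp add: \<tau>_def power_divide cube_def flip: exp_of_nat_mult)
  then have B: "Re (cis (- \<xi> * z) * (\<Prod>e\<leftarrow>x. b e)) =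
      exp (- (1 - \<rho>\<^sup>2) * \<xi>\<^sup>2 / 2) * cos (\<xi> * (\<rho> * (sum_list x / sqrt n) - z))"
    unfolding prod_b by (simp add: \<tau>_def cos_diff algebra_simps)
  have "cos (\<xi> * (sum_list y / sqrt n - z)) = Re (cis (- \<xi> * z) * cis (\<tau> * sum_list y))" for y
    by (simp add: \<tau>_def cos_diff algebra_simps)
  then have A: "noise \<rho> (\<lambda>y. cos (\<xi> * (sum_list y / sqrt n - z))) x = Re (cis (- \<xi> * z) * (\<Prod>e\<leftarrow>x. a e))"
    by (simp only: noise_cis a_def)
  have "\<bar>Re (cis (- \<xi> * z) * (\<Prod>e\<leftarrow>x. a e)) - Re (cis (- \<xi> * z) * (\<Prod>e\<leftarrow>x. b e))\<bar>
      \<le> cmod (cis (- \<xi> * z) * ((\<Prod>e\<leftarrow>x. a e) - (\<Prod>e\<leftarrow>x. b e)))"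
    using abs_Re_le_cmod[of "cis (- \<xi> * z) * ((\<Prod>e\<leftarrow>x. a e) - (\<Prod>e\<leftarrow>x. b e))"] by (simp add: right_diff_distrib)
  also have "\<dots> \<le> min 2 (noise_error \<rho> n \<xi>)"
    using le1 le2 by (simp add: norm_mult)
  finally show ?thesis unfolding A B .
qed

lemma noise_integral:
  assumes "\<And>y. integrable M (\<lambda>\<omega>. F \<omega> y)"
  shows "integrable M (\<lambda>\<omega>. noise \<rho> (F \<omega>) x)"
    and "noise \<rho> (\<lambda>y. \<integral>\<omega>. F \<omega> y \<partial>M) x = (\<integral>\<omega>. noise \<rho> (F \<omega>) x \<partial>M)"
proof -
  have "integrable M (\<lambda>\<omega>. noise \<rho> (F \<omega>) x) \<and>
      noise \<rho> (\<lambda>y. \<integral>\<omega>. F \<omega> y \<partial>M) x = (\<integral>\<omega>. noise \<rho> (F \<omega>) x \<partial>M)"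
    using assms
  proof (induction x arbitrary: F)
    case (Cons e x)
    show ?case
      using Cons.IH[of "\<lambda>\<omega> y. F \<omega> (1 # y)"] Cons.IH[of "\<lambda>\<omega> y. F \<omega> (-1 # y)"] Cons.prems by simp
  qed simp
  then show "integrable M (\<lambda>\<omega>. noise \<rho> (F \<omega>) x)"
    and "noise \<rho> (\<lambda>y. \<integral>\<omega>. F \<omega> y \<partial>M) x = (\<integral>\<omega>. noise \<rho> (F \<omega>) x \<partial>M)" by auto
qed

section \<open>Gaussians as Fourier integrals\<close>

lemma has_bochner_integral_gaussian:
  fixes c m :: real
  assumes "c > 0"
  shows "has_bochner_integral lborel (\<lambda>x. exp (- c * (x - m)\<^sup>2)) (sqrt (pi / c))"
proof -
  have "exp (- c * (x - m)\<^sup>2) = sqrt (pi / c) * normal_density m (sqrt (1 / (2 * c))) x" for x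
  proof -
    have s: "(sqrt (1 / (2 * c)))\<^sup>2 = 1 / (2 * c)" using assms by simp
    show ?thesis using assms unfolding normal_density_def s by (simp add: real_sqrt_divide)
  qed
  moreover have "has_bochner_integral lborel (normal_density m (sqrt (1 / (2 * c)))) 1"
    using assms by (simp add: has_bochner_integral_iff)
  ultimately show ?thesis
    using has_bochner_integral_mult_right[of "sqrt (pi / c)" lborel _ 1] assms by simp
qed

lemmas integrable_gaussian = integrable.intros[OF has_bochner_integral_gaussian]
  and integral_gaussian = has_bochner_integral_integral_eq[OF has_bochner_integral_gaussian]

lemma integral_std_normal_cos: "(\<integral>x. std_normal_density x * cos (t * x) \<partial>lborel) = exp (- t\<^sup>2 / 2)"
proof -
  have int: "integrable std_normal_distribution (\<lambda>x. iexp (t * x))"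
    using real_dist_normal_dist
    by (intro finite_measure.integrable_const_bound[where B = 1])
       (auto simp: real_distribution_def prob_space_def)
  have "exp (- t\<^sup>2 / 2) = Re (char std_normal_distribution t)"
    unfolding char_std_normal_distribution by simp
  also have "\<dots> = (\<integral>x. Re (iexp (t * x)) \<partial>std_normal_distribution)"
    unfolding char_def using int by (rule integral_Re[symmetric])
  also have "\<dots> = (\<integral>x. std_normal_density x * cos (t * x) \<partial>lborel)"
    by (subst integral_density) (auto simp: Re_exp)
  finally show ?thesis by simp
qed

text \<open>A rescaling of the normal characteristic function. At c = 1 it writes exp (- z^2 / 4) as
  a superposition of cosines with density exp (- \<xi>^2) / sqrt pi; at c = 4/3 it identifies the
  noisy image of that superposition.\<close>

lemma integral_gaussian_cos:
  fixes c z :: real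
  assumes "c > 0"
  shows "(\<integral>\<xi>. exp (- c * \<xi>\<^sup>2) * cos (\<xi> * z) \<partial>lborel) = sqrt (pi / c) * exp (- z\<^sup>2 / (4 * c))"
proof -
  define r where "r = 1 / sqrt (2 * c)"
  have r: "r > 0" "c * r\<^sup>2 = 1 / 2" using assms by (simp_all add: r_def power_divide)
  have "(\<integral>\<xi>. exp (- c * \<xi>\<^sup>2) * cos (\<xi> * z) \<partial>lborel)
      = r * (\<integral>x. exp (- c * (r * x)\<^sup>2) * cos (r * x * z) \<partial>lborel)"
    using r by (subst lborel_integral_real_affine[where c = r and t = 0]) auto
  also have "(\<lambda>x. exp (- c * (r * x)\<^sup>2) * cos (r * x * z)) =
      (\<lambda>x. sqrt (2 * pi) * (std_normal_density x * cos (r * z * x)))"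
  proof
    fix x
    have "- c * (r * x)\<^sup>2 = - (c * r\<^sup>2) * x\<^sup>2" by (simp add: power_mult_distrib)
    then have "- c * (r * x)\<^sup>2 = - x\<^sup>2 / 2" unfolding r(2) by simp
    then show "exp (- c * (r * x)\<^sup>2) * cos (r * x * z) = sqrt (2 * pi) * (std_normal_density x * cos (r * z * x))"
      by (simp add: std_normal_density_def mult.commute mult.left_commute)
  qed
  also have "r * (\<integral>x. \<dots> x \<partial>lborel) = r * sqrt (2 * pi) * exp (- (r * z)\<^sup>2 / 2)"
    using integral_std_normal_cos[of "r * z"] by (simp add: mult.assoc)
  also have "(r * z)\<^sup>2 / 2 = z\<^sup>2 / (4 * c)"
    using assms by (simp add: r_def power_mult_distrib power_divide)
  then have "exp (- (r * z)\<^sup>2 / 2) = exp (- z\<^sup>2 / (4 * c))" by simp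
  also have "r * sqrt (2 * pi) = sqrt (pi / c)"
    by (simp add: r_def real_sqrt_divide real_sqrt_mult)
  finally show ?thesis .
qed

text \<open>The error per frequency, averaged with the Fourier density of exp (- z^2 / 4).\<close>

definition gaussian_noise_error :: "real \<Rightarrow> nat \<Rightarrow> real" where
  "gaussian_noise_error \<rho> n = (\<integral>\<xi>. exp (- \<xi>\<^sup>2) / sqrt pi * min 2 (noise_error \<rho> n \<xi>) \<partial>lborel)"

lemma noise_error_nonneg: "0 \<le> noise_error \<rho> n \<xi>"
  by (simp add: noise_error_def)

lemma measurable_noise_error [measurable]: "noise_error \<rho> n \<in> borel_measurable borel"
  unfolding noise_error_def Complex_eq cis_conv_exp by measurable

lemma integrable_exp_neg_square: "integrable lborel (\<lambda>\<xi>::real. exp (- \<xi>\<^sup>2))"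
  using integrable_gaussian[of 1 0] by simp

lemma integrable_gaussian_noise_error:
  "integrable lborel (\<lambda>\<xi>. exp (- \<xi>\<^sup>2) / sqrt pi * min 2 (noise_error \<rho> n \<xi>))"
proof (rule Bochner_Integration.integrable_bound)
  show "integrable lborel (\<lambda>\<xi>. 2 * (exp (- \<xi>\<^sup>2) / sqrt pi))"
    using integrable_exp_neg_square by simp
  show "AE \<xi> in lborel. norm (exp (- \<xi>\<^sup>2) / sqrt pi * min 2 (noise_error \<rho> n \<xi>))
      \<le> norm (2 * (exp (- \<xi>\<^sup>2) / sqrt pi))"
    by (intro AE_I2) (auto simp: abs_mult noise_error_nonneg intro!: divide_right_mono)
qed measurable

lemma gaussian_noise_error_tendsto_0: "gaussian_noise_error \<rho> \<longlonglongrightarrow> 0"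
proof -
  have "(\<lambda>n. gaussian_noise_error \<rho> n) \<longlonglongrightarrow> (\<integral>\<xi>. 0 \<partial>(lborel :: real measure))"
    unfolding gaussian_noise_error_def
  proof (rule integral_dominated_convergence)
    show "integrable lborel (\<lambda>\<xi>. 2 * (exp (- \<xi>\<^sup>2) / sqrt pi))"
      using integrable_exp_neg_square by simp
    show "AE \<xi> in lborel. norm (exp (- \<xi>\<^sup>2) / sqrt pi * min 2 (noise_error \<rho> n \<xi>))
        \<le> 2 * (exp (- \<xi>\<^sup>2) / sqrt pi)" for n
      by (intro AE_I2) (auto simp: abs_mult noise_error_nonneg intro!: divide_right_mono)
    have "(\<lambda>n. exp (- \<xi>\<^sup>2) / sqrt pi * min 2 (noise_error \<rho> n \<xi>))
        \<longlonglongrightarrow> exp (- \<xi>\<^sup>2) / sqrt pi * min 2 0" for \<xi>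
      by (intro tendsto_intros noise_error_tendsto_0) 
    then show "AE \<xi> in lborel. (\<lambda>n. exp (- \<xi>\<^sup>2) / sqrt pi * min 2 (noise_error \<rho> n \<xi>)) \<longlonglongrightarrow> 0"
      by simp
  qed measurable
  then show ?thesis by simp
qed

lemma gaussian_noise_error_bounds: "0 \<le> gaussian_noise_error \<rho> n" "gaussian_noise_error \<rho> n \<le> 2"
proof -
  show "0 \<le> gaussian_noise_error \<rho> n"
    unfolding gaussian_noise_error_def by (rule integral_nonneg_AE) (simp add: noise_error_nonneg)
  have "gaussian_noise_error \<rho> n \<le> (\<integral>\<xi>. 2 / sqrt pi * exp (- \<xi>\<^sup>2) \<partial>lborel)"
    unfolding gaussian_noise_error_def
    by (rule integral_mono[OF integrable_gaussian_noise_error])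
       (auto intro!: divide_right_mono simp: integrable_exp_neg_square)
  also have "\<dots> = 2" using integral_gaussian[of 1 0] by simp
  finally show "gaussian_noise_error \<rho> n \<le> 2" .
qed

text \<open>Noise is a finite linear combination, so it passes under the Fourier integral. There it
  damps frequency \<xi> by about exp (- \<xi>^2 / 3), because (1 - \<rho>^2) / 2 = 1/3. The density
  becomes exp (- (4/3) \<xi>^2), whose cosine transform has exponent 3/16 and prefactor sqrt 3 / 2:
  the variance grows from 2 to 2 + 2/3.\<close>

lemma noise_gaussian:
  assumes "0 < n" "x \<in> cube n"
  shows "\<bar>noise (1 / sqrt 3) (\<lambda>y. exp (- (sum_list y / sqrt n - z)\<^sup>2 / 4)) x
     - sqrt 3 / 2 * exp (- 3 / 16 * (sum_list x / sqrt n / sqrt 3 - z)\<^sup>2)\<bar>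
     \<le> gaussian_noise_error (1 / sqrt 3) n"
proof -
  define \<rho> :: real where "\<rho> = 1 / sqrt 3"
  define F where "F = (\<lambda>(\<xi>::real) y. exp (- \<xi>\<^sup>2) / sqrt pi * cos (\<xi> * (sum_list y / sqrt n - z)))"
  define G where "G = (\<lambda>\<xi>. exp (- \<xi>\<^sup>2) / sqrt pi *
     (exp (- (1 - \<rho>\<^sup>2) * \<xi>\<^sup>2 / 2) * cos (\<xi> * (\<rho> * (sum_list x / sqrt n) - z))))"
  have \<rho>: "0 \<le> \<rho>" "\<rho> \<le> 1" "\<rho>\<^sup>2 = 1 / 3" by (simp_all add: \<rho>_def power_divide)
  have F: "integrable lborel (\<lambda>\<xi>. F \<xi> y)" for y
  proof (rule Bochner_Integration.integrable_bound)
    show "integrable lborel (\<lambda>\<xi>::real. exp (- \<xi>\<^sup>2) / sqrt pi)"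
      using integrable_exp_neg_square by simp
    show "AE \<xi> in lborel. norm (F \<xi> y) \<le> norm (exp (- \<xi>\<^sup>2) / sqrt pi)"
      unfolding F_def by (intro AE_I2) (auto simp: abs_mult intro!: divide_right_mono mult_left_le)
  qed (simp add: F_def)
  have "(\<integral>\<xi>. F \<xi> y \<partial>lborel) = exp (- (sum_list y / sqrt n - z)\<^sup>2 / 4)" for y
    using integral_gaussian_cos[of 1 "sum_list y / sqrt n - z"] unfolding F_def by simp
  then have E: "noise \<rho> (\<lambda>y. exp (- (sum_list y / sqrt n - z)\<^sup>2 / 4)) x = (\<integral>\<xi>. noise \<rho> (F \<xi>) x \<partial>lborel)"
    using noise_integral(2)[of lborel F \<rho> x, OF F] by simp
  have G': "G \<xi> = 1 / sqrt pi * (exp (- (4/3) * \<xi>\<^sup>2) * cos (\<xi> * (\<rho> * (sum_list x / sqrt n) - z)))" for \<xi>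
  proof -
    have "exp (- \<xi>\<^sup>2) * exp (- (1 - \<rho>\<^sup>2) * \<xi>\<^sup>2 / 2) = exp (- (4/3) * \<xi>\<^sup>2)"
      unfolding \<rho> by (simp add: field_simps flip: exp_add)
    then show ?thesis unfolding G_def by (simp add: mult_ac)
  qed
  have intG: "integrable lborel G"
  proof (rule Bochner_Integration.integrable_bound)
    show "integrable lborel (\<lambda>\<xi>::real. 1 / sqrt pi * exp (- (4/3) * \<xi>\<^sup>2))"
      using integrable_gaussian[of "4/3" 0] by simp
    show "AE \<xi> in lborel. norm (G \<xi>) \<le> norm (1 / sqrt pi * exp (- (4/3) * \<xi>\<^sup>2))"
      unfolding G' by (intro AE_I2) (auto simp: abs_mult intro!: divide_right_mono mult_left_le)
  qed (simp add: G_def)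
  have "(\<integral>\<xi>. G \<xi> \<partial>lborel) = 1 / sqrt pi * (sqrt (pi / (4/3)) * exp (- (\<rho> * (sum_list x / sqrt n) - z)\<^sup>2 / (4 * (4/3))))"
    unfolding G' by (subst integral_mult_right_zero, subst integral_gaussian_cos) auto
  also have "\<dots> = sqrt 3 / 2 * exp (- 3 / 16 * (sum_list x / sqrt n / sqrt 3 - z)\<^sup>2)"
    by (simp add: \<rho>_def real_sqrt_divide real_sqrt_mult field_simps)
  finally have D: "(\<integral>\<xi>. G \<xi> \<partial>lborel) = sqrt 3 / 2 * exp (- 3 / 16 * (sum_list x / sqrt n / sqrt 3 - z)\<^sup>2)" .
  have "\<bar>(\<integral>\<xi>. noise \<rho> (F \<xi>) x \<partial>lborel) - (\<integral>\<xi>. G \<xi> \<partial>lborel)\<bar> = \<bar>\<integral>\<xi>. noise \<rho> (F \<xi>) x - G \<xi> \<partial>lborel\<bar>"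
    using noise_integral(1)[of lborel F, OF F] intG by simp
  also have "\<dots> \<le> (\<integral>\<xi>. \<bar>noise \<rho> (F \<xi>) x - G \<xi>\<bar> \<partial>lborel)"
    by (rule integral_abs_bound)
  also have "\<dots> \<le> gaussian_noise_error \<rho> n"
    unfolding gaussian_noise_error_def
  proof (rule integral_mono)
    fix \<xi> :: real
    have "noise \<rho> (F \<xi>) x = exp (- \<xi>\<^sup>2) / sqrt pi * noise \<rho> (\<lambda>y. cos (\<xi> * (sum_list y / sqrt n - z))) x"
      unfolding F_def by (rule noise_cmult)
    then have "\<bar>noise \<rho> (F \<xi>) x - G \<xi>\<bar> = exp (- \<xi>\<^sup>2) / sqrt pi * \<bar>noise \<rho> (\<lambda>y. cos (\<xi> * (sum_list y / sqrt n - z))) x -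
        (exp (- (1 - \<rho>\<^sup>2) * \<xi>\<^sup>2 / 2) * cos (\<xi> * (\<rho> * (sum_list x / sqrt n) - z)))\<bar>"
      unfolding G_def by (simp only: right_diff_distrib[symmetric] abs_mult) simp
    also have "\<dots> \<le> exp (- \<xi>\<^sup>2) / sqrt pi * min 2 (noise_error \<rho> n \<xi>)"
      using noise_cos[OF \<rho>(1,2) assms, of \<xi> z] by (intro mult_left_mono) auto
    finally show "\<bar>noise \<rho> (F \<xi>) x - G \<xi>\<bar> \<le> exp (- \<xi>\<^sup>2) / sqrt pi * min 2 (noise_error \<rho> n \<xi>)" .
  qed (use noise_integral(1)[of lborel F, OF F] intG integrable_gaussian_noise_error in auto)
  finally show ?thesis unfolding E D[symmetric] \<rho>_def[symmetric] .
qed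

section \<open>Gaussian mixtures and the limit inequality\<close>

lemma integrable_bounded_mult:
  fixes w k :: "real \<Rightarrow> real"
  assumes "integrable lborel w" "k \<in> borel_measurable borel" "\<And>y. \<bar>k y\<bar> \<le> 1"
  shows "integrable lborel (\<lambda>y. w y * k y)"
  by (rule Bochner_Integration.integrable_bound[OF assms(1)])
     (use assms in \<open>auto simp: abs_mult intro!: AE_I2 mult_left_le\<close>)

lemma abs_integral_bounded_mult_le:
  fixes w k :: "real \<Rightarrow> real"
  assumes "integrable lborel w" "k \<in> borel_measurable borel" "\<And>y. \<bar>k y\<bar> \<le> c"
  shows "\<bar>\<integral>y. w y * k y \<partial>lborel\<bar> \<le> (\<integral>y. \<bar>w y\<bar> \<partial>lborel) * c"
proof -
  have "c \<ge> 0" using assms(3)[of 0] by linarith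
  have int: "integrable lborel (\<lambda>y. w y * k y)"
    by (rule Bochner_Integration.integrable_bound[of lborel "\<lambda>y. w y * c"])
       (use assms \<open>c \<ge> 0\<close> in \<open>auto simp: abs_mult intro!: AE_I2 mult_left_mono\<close>)
  have "\<bar>\<integral>y. w y * k y \<partial>lborel\<bar> \<le> (\<integral>y. \<bar>w y * k y\<bar> \<partial>lborel)"
    by (rule integral_abs_bound)
  also have "\<dots> \<le> (\<integral>y. \<bar>w y\<bar> * c \<partial>lborel)"
  proof (rule integral_mono)
    show "integrable lborel (\<lambda>y. \<bar>w y * k y\<bar>)" using int by (rule integrable_abs)
  qed (use assms in \<open>auto simp: abs_mult intro!: mult_left_mono\<close>)
  also have "\<dots> = (\<integral>y. \<bar>w y\<bar> \<partial>lborel) * c" by simp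
  finally show ?thesis .
qed

text \<open>Dominated convergence with majorant \<open>\<bar>w y\<bar>\<close>. The parameters cover
  both \<open>h\<close> (b = 1, c = 1/4) and \<open>H\<close> (b = 1 / sqrt 3, c = 3/16), which must
  be continuous to serve as test functions of the central limit theorem.\<close>

lemma isCont_gaussian_mixture:
  fixes w :: "real \<Rightarrow> real"
  assumes w: "integrable lborel w" and c: "c \<ge> 0"
  shows "isCont (\<lambda>s. \<integral>y. w y * exp (- c * (b * s - 2 * y)\<^sup>2) \<partial>lborel) s"
  unfolding continuous_at_sequentially comp_def
proof (intro allI impI)
  fix X :: "nat \<Rightarrow> real" assume X: "X \<longlonglongrightarrow> s"
  show "(\<lambda>n. \<integral>y. w y * exp (- c * (b * X n - 2 * y)\<^sup>2) \<partial>lborel) \<longlonglongrightarrow>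
      (\<integral>y. w y * exp (- c * (b * s - 2 * y)\<^sup>2) \<partial>lborel)"
  proof (rule integral_dominated_convergence)
    show "integrable lborel (\<lambda>y. \<bar>w y\<bar>)" using w by simp
    show "AE y in lborel. (\<lambda>n. w y * exp (- c * (b * X n - 2 * y)\<^sup>2)) \<longlonglongrightarrow> w y * exp (- c * (b * s - 2 * y)\<^sup>2)"
      by (intro AE_I2 tendsto_intros X)
    show "AE y in lborel. norm (w y * exp (- c * (b * X n - 2 * y)\<^sup>2)) \<le> \<bar>w y\<bar>" for n
      using c by (intro AE_I2) (auto simp: abs_mult intro!: mult_left_le)
  qed (use w in measurable)
qed

text \<open>
  \<open>H\<close> is the Mehler (Ornstein-Uhlenbeck) transform of \<open>h\<close> with correlation \<open>1 / sqrt 3\<close>.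
\<close>

theorem gaussian_hypercontractivity:
  fixes w :: "real \<Rightarrow> real"
  assumes w: "integrable lborel w"
  defines "h \<equiv> (\<lambda>s. \<integral>y. w y * exp (- (s - 2 * y)\<^sup>2 / 4) \<partial>lborel)"
    and "H \<equiv> (\<lambda>s. sqrt 3 / 2 * (\<integral>y. w y * exp (- 3 / 16 * (s / sqrt 3 - 2 * y)\<^sup>2) \<partial>lborel))"
  shows "(\<integral>x. std_normal_density x * H x ^ 4 \<partial>lborel) \<le> (\<integral>x. std_normal_density x * (h x)\<^sup>2 \<partial>lborel)\<^sup>2"
proof -
  define \<rho> :: real where "\<rho> = 1 / sqrt 3"
  define B where "B = (\<integral>y. \<bar>w y\<bar> \<partial>lborel)"
  have [measurable]: "w \<in> borel_measurable borel" using w by auto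
  have B: "B \<ge> 0" unfolding B_def by simp
  have contH: "isCont H s" for s
    unfolding H_def using isCont_gaussian_mixture[OF w, where c = "3/16" and b = "1 / sqrt 3" and s = s]
    by (intro continuous_intros) simp
  have conth: "isCont h s" for s
    unfolding h_def using isCont_gaussian_mixture[OF w, where c = "1/4" and b = 1 and s = s] by simp
  have "\<bar>\<integral>y. w y * exp (- 3 / 16 * (s / sqrt 3 - 2 * y)\<^sup>2) \<partial>lborel\<bar> \<le> B" for s
    using abs_integral_bounded_mult_le[OF w, of "\<lambda>y. exp (- 3 / 16 * (s / sqrt 3 - 2 * y)\<^sup>2)" 1] by (simp add: B_def)
  moreover have "sqrt 3 / 2 \<le> (1::real)" by (simp add: real_le_lsqrt)
  ultimately have absH: "\<bar>H s\<bar> \<le> B" for s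
    unfolding H_def abs_mult using mult_mono[of "\<bar>sqrt 3 / 2\<bar>" 1 _ B] by simp
  have absh: "\<bar>h s\<bar> \<le> B" for s
    unfolding h_def using abs_integral_bounded_mult_le[OF w, of "\<lambda>y. exp (- (s - 2 * y)\<^sup>2 / 4)" 1] by (simp add: B_def)
  have diff: "\<bar>noise \<rho> (\<lambda>y. h (sum_list y / sqrt n)) x - H (sum_list x / sqrt n)\<bar> \<le> B * gaussian_noise_error \<rho> n"
    if "0 < n" "x \<in> cube n" for n x
  proof -
    define K where "K = (\<lambda>z. noise \<rho> (\<lambda>y. exp (- (sum_list y / sqrt n - z)\<^sup>2 / 4)) x)"
    define L where "L = (\<lambda>z. sqrt 3 / 2 * exp (- 3 / 16 * (sum_list x / sqrt n / sqrt 3 - z)\<^sup>2))"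
    have int: "integrable lborel (\<lambda>z. w z * exp (- (sum_list y / sqrt n - 2 * z)\<^sup>2 / 4))" for y
      by (rule integrable_bounded_mult[OF w]) auto
    have nc: "noise \<rho> (\<lambda>y. w z * exp (- (sum_list y / sqrt n - 2 * z)\<^sup>2 / 4)) x = w z * K (2 * z)" for z
      unfolding K_def by (rule noise_cmult)
    note I = noise_integral[of lborel "\<lambda>z y. w z * exp (- (sum_list y / sqrt n - 2 * z)\<^sup>2 / 4)" \<rho> x, OF int, unfolded nc]
    have [measurable]: "K \<in> borel_measurable borel"
    proof -
      \<comment> \<open>\<open>noise\<close> recurses on x while prepending coordinates to the
        argument; the prefix xs collects these, so that the induction hypothesis applies.\<close>
      have "(\<lambda>z. noise \<rho> (\<lambda>y. exp (- (sum_list (xs @ y) / sqrt n - z)\<^sup>2 / 4)) x) \<in> borel_measurable borel" for xs x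
      proof (induction x arbitrary: xs)
        case (Cons e x)
        show ?case using Cons[of "xs @ [1]"] Cons[of "xs @ [-1]"] by (simp add: algebra_simps)
      qed simp
      from this[of "[]" x] show ?thesis by (simp add: K_def)
    qed
    have [measurable]: "L \<in> borel_measurable borel" unfolding L_def by measurable
    have intL: "integrable lborel (\<lambda>z. w z * L (2 * z))"
    proof -
      have "integrable lborel (\<lambda>z. sqrt 3 / 2 * (w z * exp (- 3 / 16 * (sum_list x / sqrt n / sqrt 3 - 2 * z)\<^sup>2)))"
        by (intro integrable_mult_right integrable_bounded_mult[OF w]) auto
      then show ?thesis unfolding L_def by (simp add: mult_ac)
    qed
    have "noise \<rho> (\<lambda>y. h (sum_list y / sqrt n)) x - H (sum_list x / sqrt n) =
        (\<integral>z. w z * K (2 * z) \<partial>lborel) - (\<integral>z. w z * L (2 * z) \<partial>lborel)"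
    proof -
      have "(\<integral>z. w z * L (2 * z) \<partial>lborel) = H (sum_list x / sqrt n)"
        unfolding H_def L_def by (subst integral_mult_right_zero[symmetric]) (simp add: mult_ac)
      then show ?thesis unfolding h_def I(2) by simp
    qed
    also have "\<dots> = (\<integral>z. w z * (K (2 * z) - L (2 * z)) \<partial>lborel)"
      using I(1) intL by (simp add: right_diff_distrib)
    finally have eq: "noise \<rho> (\<lambda>y. h (sum_list y / sqrt n)) x - H (sum_list x / sqrt n) =
        (\<integral>z. w z * (K (2 * z) - L (2 * z)) \<partial>lborel)" .
    show ?thesis
      unfolding eq B_def
    proof (rule abs_integral_bounded_mult_le[OF w])
      show "\<bar>K (2 * z) - L (2 * z)\<bar> \<le> gaussian_noise_error \<rho> n" for z
        unfolding K_def L_def \<rho>_def by (rule noise_gaussian[OF that])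
    qed measurable
  qed
  \<comment> \<open>The cube inequality bounds the noise of \<open>h\<close>, which varies with n.
    Replacing it by the fixed function \<open>H\<close> of the normalised sum costs a vanishing
    uniform error and makes the central limit theorem applicable.\<close>
  have step: "cube_mean n (\<lambda>x. H (sum_list x / sqrt n) ^ 4)
      \<le> (cube_mean n (\<lambda>x. (h (sum_list x / sqrt n))\<^sup>2))\<^sup>2 + 40 * B ^ 4 * gaussian_noise_error \<rho> n"
    if "0 < n" for n
  proof -
    let ?e = "gaussian_noise_error \<rho> n"
    have "cube_mean n (\<lambda>x. H (sum_list x / sqrt n) ^ 4) \<le>
        cube_mean n (\<lambda>x. noise \<rho> (\<lambda>y. h (sum_list y / sqrt n)) x ^ 4 + 40 * B ^ 4 * ?e)"
    proof (rule cube_mean_mono)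
      fix x assume x: "x \<in> cube n"
      define u v where "u = noise \<rho> (\<lambda>y. h (sum_list y / sqrt n)) x" and "v = H (sum_list x / sqrt n)"
      have uv: "\<bar>u - v\<bar> \<le> B * ?e" unfolding u_def v_def by (rule diff[OF that x])
      also have "\<dots> \<le> B * 2" using B gaussian_noise_error_bounds by (intro mult_left_mono) auto
      finally have v: "\<bar>v\<bar> \<le> B" and u: "\<bar>u\<bar> \<le> 3 * B" using absH[of "sum_list x / sqrt n"] by (auto simp: v_def)
      \<comment> \<open>With \<open>\<bar>v\<bar> \<le> B\<close> and
        \<open>\<bar>u\<bar> \<le> 3 * B\<close>, the factors v + u and v^2 + u^2 are at most 4 B
        and (1 + 9) B^2, whence the 40.\<close>
      have "v ^ 4 - u ^ 4 = (v - u) * ((v + u) * (v\<^sup>2 + u\<^sup>2))"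
        by (simp add: power4_eq_xxxx power2_eq_square algebra_simps)
      also have "\<dots> \<le> \<bar>v - u\<bar> * (\<bar>v + u\<bar> * (v\<^sup>2 + u\<^sup>2))"
        by (simp add: abs_mult[symmetric] mult.assoc[symmetric] mult_right_mono)
      also have "\<dots> \<le> (B * ?e) * ((4 * B) * (B\<^sup>2 + (3 * B)\<^sup>2))"
        using u v uv B power_mono[OF u, of 2] power_mono[OF v, of 2]
        by (intro mult_mono add_mono) (auto simp: gaussian_noise_error_bounds)
      also have "\<dots> = 40 * B ^ 4 * ?e" by (simp add: power4_eq_xxxx power2_eq_square)
      finally show "H (sum_list x / sqrt n) ^ 4 \<le> noise \<rho> (\<lambda>y. h (sum_list y / sqrt n)) x ^ 4 + 40 * B ^ 4 * ?e"
        unfolding u_def v_def by simp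
    qed
    also have "\<dots> = cube_mean n (\<lambda>x. noise \<rho> (\<lambda>y. h (sum_list y / sqrt n)) x ^ 4) + 40 * B ^ 4 * ?e"
      by (simp only: cube_mean_add cube_mean_const)
    also have "cube_mean n (\<lambda>x. noise \<rho> (\<lambda>y. h (sum_list y / sqrt n)) x ^ 4)
        \<le> (cube_mean n (\<lambda>x. (h (sum_list x / sqrt n))\<^sup>2))\<^sup>2"
      by (rule hypercontractive_2_4) (simp add: \<rho>_def power_divide)
    finally show ?thesis by simp
  qed
  have "\<bar>H s ^ 4\<bar> \<le> B ^ 4" for s using power_mono[OF absH[of s], of 4] by (simp add: power_abs)
  then have limH: "(\<lambda>n. cube_mean n (\<lambda>x. H (sum_list x / sqrt n) ^ 4))
      \<longlonglongrightarrow> (\<integral>x. std_normal_density x * H x ^ 4 \<partial>lborel)"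
    by (intro cube_mean_tendsto_normal[where F = "\<lambda>x. H x ^ 4"] continuous_intros contH)
  have "\<bar>(h s)\<^sup>2\<bar> \<le> B\<^sup>2" for s using power_mono[OF absh[of s], of 2] by simp
  then have "(\<lambda>n. cube_mean n (\<lambda>x. (h (sum_list x / sqrt n))\<^sup>2))
      \<longlonglongrightarrow> (\<integral>x. std_normal_density x * (h x)\<^sup>2 \<partial>lborel)"
    by (intro cube_mean_tendsto_normal[where F = "\<lambda>x. (h x)\<^sup>2"] continuous_intros conth)
  then have "(\<lambda>n. (cube_mean n (\<lambda>x. (h (sum_list x / sqrt n))\<^sup>2))\<^sup>2 + 40 * B ^ 4 * gaussian_noise_error \<rho> n)
      \<longlonglongrightarrow> (\<integral>x. std_normal_density x * (h x)\<^sup>2 \<partial>lborel)\<^sup>2 + 40 * B ^ 4 * 0"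
    by (intro tendsto_intros gaussian_noise_error_tendsto_0)
  then have "(\<integral>x. std_normal_density x * H x ^ 4 \<partial>lborel)
      \<le> (\<integral>x. std_normal_density x * (h x)\<^sup>2 \<partial>lborel)\<^sup>2 + 40 * B ^ 4 * 0"
    using step by (intro LIMSEQ_le[OF limH]) (auto intro!: exI[of _ 1])
  then show ?thesis by simp
qed

section \<open>Smoothing by a Gaussian kernel\<close>

lemma nn_integral_gaussian:
  fixes c m :: real
  assumes "c > 0"
  shows "(\<integral>\<^sup>+x. ennreal (exp (- c * (x - m)\<^sup>2)) \<partial>lborel) = ennreal (sqrt (pi / c))"
  using integrable_gaussian[OF assms, of m] integral_gaussian[OF assms, of m]
  by (subst nn_integral_eq_integral) auto

lemma ennreal_gaussian_mixture:
  fixes f k :: "real \<Rightarrow> real"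
  assumes "integrable lborel f" "\<And>y. 0 \<le> f y"
    "k \<in> borel_measurable borel" "\<And>y. 0 \<le> k y" "\<And>y. k y \<le> 1"
  shows "ennreal (\<integral>y. f y * k y \<partial>lborel) = (\<integral>\<^sup>+y. ennreal (f y) * ennreal (k y) \<partial>lborel)"
proof -
  have "(\<integral>\<^sup>+y. ennreal (f y * k y) \<partial>lborel) = ennreal (\<integral>y. f y * k y \<partial>lborel)"
    using assms by (intro nn_integral_eq_integral integrable_bounded_mult) auto
  then show ?thesis using assms by (simp add: ennreal_mult)
qed

text \<open>The semigroup property of Gaussians: expanding the square and completing the square in s
  about (x + y) / 2 leaves exp (- (x - y)^2 / 4) and the mass sqrt pi. With nonnegative extended
  integrals both changes of order are instances of Tonelli's theorem.\<close>

lemma nn_integral_gaussian_square: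
  fixes f :: "real \<Rightarrow> real"
  assumes [measurable]: "f \<in> borel_measurable borel" and f: "\<And>y. 0 \<le> f y"
  shows "(\<integral>\<^sup>+s. (\<integral>\<^sup>+y. ennreal (f y) * ennreal (exp (- (s - y)\<^sup>2 / 2)) \<partial>lborel)\<^sup>2 \<partial>lborel)
    = ennreal (sqrt pi) * (\<integral>\<^sup>+x. ennreal (f x) * (\<integral>\<^sup>+y. ennreal (f y) * ennreal (exp (- (x - y)\<^sup>2 / 4)) \<partial>lborel) \<partial>lborel)"
proof -
  let ?k = "\<lambda>s y. ennreal (exp (- (s - y)\<^sup>2 / 2))"
  have "(\<integral>\<^sup>+s. (\<integral>\<^sup>+y. f y * ?k s y \<partial>lborel)\<^sup>2 \<partial>lborel)
      = (\<integral>\<^sup>+s. (\<integral>\<^sup>+x. \<integral>\<^sup>+y. (f x * ?k s x) * (f y * ?k s y) \<partial>lborel \<partial>lborel) \<partial>lborel)"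
    by (simp add: power2_eq_square nn_integral_cmult nn_integral_multc)
  also have "\<dots> = (\<integral>\<^sup>+x. \<integral>\<^sup>+s. \<integral>\<^sup>+y. (f x * ?k s x) * (f y * ?k s y) \<partial>lborel \<partial>lborel \<partial>lborel)"
    by (rule lborel_pair.Fubini') measurable
  also have "\<dots> = (\<integral>\<^sup>+x. \<integral>\<^sup>+y. \<integral>\<^sup>+s. (f x * ?k s x) * (f y * ?k s y) \<partial>lborel \<partial>lborel \<partial>lborel)"
    by (intro nn_integral_cong lborel_pair.Fubini') measurable
  also have "\<dots> = (\<integral>\<^sup>+x. \<integral>\<^sup>+y. ennreal (sqrt pi) * (ennreal (f x) * (f y * ennreal (exp (- (x - y)\<^sup>2 / 4)))) \<partial>lborel \<partial>lborel)"
  proof (intro nn_integral_cong)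
    fix x y :: real
    have "(f x * ?k s x) * (f y * ?k s y) =
        ennreal (f x) * (f y * ennreal (exp (- (x - y)\<^sup>2 / 4))) * ennreal (exp (- 1 * (s - (x + y) / 2)\<^sup>2))" for s
    proof -
      have "- (s - x)\<^sup>2 / 2 + - (s - y)\<^sup>2 / 2 = - (x - y)\<^sup>2 / 4 + - 1 * (s - (x + y) / 2)\<^sup>2"
        by (simp add: power2_eq_square field_simps)
      then have "exp (- (s - x)\<^sup>2 / 2) * exp (- (s - y)\<^sup>2 / 2)
          = exp (- (x - y)\<^sup>2 / 4) * exp (- 1 * (s - (x + y) / 2)\<^sup>2)"
        by (simp only: exp_add[symmetric])
      then have "?k s x * ?k s y = ennreal (exp (- (x - y)\<^sup>2 / 4)) * ennreal (exp (- 1 * (s - (x + y) / 2)\<^sup>2))"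
        by (simp only: ennreal_mult'[symmetric] exp_ge_zero)
      moreover have "(f x * ?k s x) * (f y * ?k s y) = ennreal (f x) * ennreal (f y) * (?k s x * ?k s y)"
        by (simp only: mult_ac)
      ultimately show ?thesis by (simp only: mult_ac)
    qed
    then show "(\<integral>\<^sup>+s. (f x * ?k s x) * (f y * ?k s y) \<partial>lborel)
        = ennreal (sqrt pi) * (ennreal (f x) * (f y * ennreal (exp (- (x - y)\<^sup>2 / 4))))"
      using nn_integral_gaussian[of 1 "(x + y) / 2"] by (simp add: nn_integral_cmult mult_ac)
  qed
  also have "\<dots> = ennreal (sqrt pi) * (\<integral>\<^sup>+x. ennreal (f x) * (\<integral>\<^sup>+y. ennreal (f y) * ennreal (exp (- (x - y)\<^sup>2 / 4)) \<partial>lborel) \<partial>lborel)"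
    by (simp add: nn_integral_cmult)
  finally show ?thesis .
qed

lemma integrable_std_normal_mult_bounded:
  fixes F :: "real \<Rightarrow> real"
  assumes "F \<in> borel_measurable borel" "\<And>x. \<bar>F x\<bar> \<le> B"
  shows "integrable lborel (\<lambda>x. std_normal_density x * F x)"
  by (rule Bochner_Integration.integrable_bound[of lborel "\<lambda>x. std_normal_density x * B"])
     (use assms in \<open>auto simp: abs_mult normal_density_nonneg intro!: AE_I2 mult_left_mono order_trans[OF assms(2)]\<close>)

text \<open>
  The constant is read off below: with \<open>w y = f y * exp (y\<^sup>2 / 2)\<close>, the functions \<open>h\<close> and \<open>H\<close> of
  \<open>gaussian_hypercontractivity\<close> are, up to the weights \<open>exp (s\<^sup>2 / 4)\<close> and \<open>exp (s\<^sup>2 / 8)\<close>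
  that cancel the normal density, convolutions of \<open>f\<close> with Gaussians of parameters \<open>1 / 2\<close> and \<open>1 / 4\<close>.
  Compact support makes \<open>w\<close> integrable.
\<close>

definition smoothing_const :: real where
  "smoothing_const = sqrt (2 * pi) * (4 * sqrt 3 / 9)"

lemma smoothing_const_pos: "smoothing_const > 0"
  by (simp add: smoothing_const_def)

lemma smoothing_compact_support:
  fixes f :: "real \<Rightarrow> real"
  assumes int: "integrable lborel f" and f: "\<And>y. 0 \<le> f y"
    and supp: "\<And>y. \<bar>y\<bar> > R \<Longrightarrow> f y = 0"
  shows "(\<integral>\<^sup>+x. ennreal ((\<integral>y. f y * exp (- (x - y)\<^sup>2 / 4) \<partial>lborel) ^ 4) \<partial>lborel)
    \<le> ennreal smoothing_const *
      (\<integral>\<^sup>+x. ennreal (f x) * (\<integral>\<^sup>+y. ennreal (f y) * ennreal (exp (- (x - y)\<^sup>2 / 4)) \<partial>lborel) \<partial>lborel)\<^sup>2"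
    (is "?lhs \<le> _ * ?Q\<^sup>2")
proof -
  have meas [measurable]: "f \<in> borel_measurable borel" using int by auto
  define w where "w = (\<lambda>y. f y * exp (y\<^sup>2 / 2))"
  define u where "u = (\<lambda>x. \<integral>y. f y * exp (- (x - y)\<^sup>2 / 4) \<partial>lborel)"
  define \<phi> where "\<phi> = (\<lambda>s. \<integral>y. f y * exp (- (s - y)\<^sup>2 / 2) \<partial>lborel)"
  define h where "h = (\<lambda>s. \<integral>y. w y * exp (- (s - 2 * y)\<^sup>2 / 4) \<partial>lborel)"
  define H where "H = (\<lambda>s. sqrt 3 / 2 * (\<integral>y. w y * exp (- 3 / 16 * (s / sqrt 3 - 2 * y)\<^sup>2) \<partial>lborel))"
  define c where "c = 1 / sqrt (2 * pi)"
  have c: "c > 0" by (simp add: c_def)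
  have [measurable]: "w \<in> borel_measurable borel" unfolding w_def by measurable
  have [measurable]: "u \<in> borel_measurable borel" "\<phi> \<in> borel_measurable borel"
    "h \<in> borel_measurable borel" "H \<in> borel_measurable borel"
    unfolding u_def \<phi>_def h_def H_def by measurable
  have w: "integrable lborel w"
  proof (rule Bochner_Integration.integrable_bound)
    show "integrable lborel (\<lambda>y. f y * exp (R\<^sup>2 / 2))" using int by simp
    have "f y * exp (y\<^sup>2 / 2) \<le> f y * exp (R\<^sup>2 / 2)" for y
    proof (cases "\<bar>y\<bar> > R")
      case False
      then have "y\<^sup>2 \<le> R\<^sup>2" by (intro abs_le_square_iff[THEN iffD1]) auto
      then show ?thesis using f by (intro mult_left_mono) auto
    qed (simp add: supp)
    then show "AE y in lborel. norm (w y) \<le> norm (f y * exp (R\<^sup>2 / 2))"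
      using f by (simp add: w_def)
  qed measurable
  have u0: "0 \<le> u x" for x unfolding u_def using f by (intro integral_nonneg_AE) auto
  have h: "h s = exp (s\<^sup>2 / 4) * \<phi> s" for s
  proof -
    have "y\<^sup>2 / 2 + - (s - 2 * y)\<^sup>2 / 4 = s\<^sup>2 / 4 + - (s - y)\<^sup>2 / 2" for y
      by (simp add: power2_eq_square field_simps)
    then have "exp (y\<^sup>2 / 2) * exp (- (s - 2 * y)\<^sup>2 / 4) = exp (s\<^sup>2 / 4) * exp (- (s - y)\<^sup>2 / 2)" for y
      by (simp only: exp_add[symmetric])
    then have "w y * exp (- (s - 2 * y)\<^sup>2 / 4) = exp (s\<^sup>2 / 4) * (f y * exp (- (s - y)\<^sup>2 / 2))" for y
      unfolding w_def by (simp only: mult.assoc mult.left_commute[of "f y"])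
    then show ?thesis unfolding h_def \<phi>_def by simp
  qed
  have H: "H s = exp (s\<^sup>2 / 8) * (sqrt 3 / 2 * u (sqrt 3 / 2 * s))" for s
  proof -
    have "y\<^sup>2 / 2 + - 3 / 16 * (s / sqrt 3 - 2 * y)\<^sup>2 = s\<^sup>2 / 8 + - (sqrt 3 / 2 * s - y)\<^sup>2 / 4" for y
    proof -
      \<comment> \<open>In terms of t = s / sqrt 3 the identity has rational coefficients.\<close>
      define t where "t = s / sqrt 3"
      have s: "s = sqrt 3 * t" by (simp add: t_def)
      then have "sqrt 3 / 2 * s = 3 / 2 * t" "s\<^sup>2 = 3 * t\<^sup>2" by (simp_all add: power_mult_distrib)
      then show ?thesis
        unfolding t_def[symmetric] by (simp add: power2_eq_square field_simps)
    qed
    then have "exp (y\<^sup>2 / 2) * exp (- 3 / 16 * (s / sqrt 3 - 2 * y)\<^sup>2) = exp (s\<^sup>2 / 8) * exp (- (sqrt 3 / 2 * s - y)\<^sup>2 / 4)" for y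
      by (simp only: exp_add[symmetric])
    then have "w y * exp (- 3 / 16 * (s / sqrt 3 - 2 * y)\<^sup>2) = exp (s\<^sup>2 / 8) * (f y * exp (- (sqrt 3 / 2 * s - y)\<^sup>2 / 4))" for y
      unfolding w_def by (simp only: mult.assoc mult.left_commute[of "f y"])
    then show ?thesis unfolding H_def u_def by simp
  qed
  have \<gamma>h: "std_normal_density s * (h s)\<^sup>2 = c * (\<phi> s)\<^sup>2" for s
  proof -
    have "exp (- s\<^sup>2 / 2) * (exp (s\<^sup>2 / 4))\<^sup>2 = 1" by (simp flip: exp_add exp_of_nat_mult)
    then show ?thesis unfolding h std_normal_density_def c_def by (simp add: power_mult_distrib)
  qed
  have \<gamma>H: "std_normal_density s * H s ^ 4 = c * 9 / 16 * u (sqrt 3 / 2 * s) ^ 4" for s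
  proof -
    have "exp (- s\<^sup>2 / 2) * exp (s\<^sup>2 / 8) ^ 4 = 1" by (simp flip: exp_add exp_of_nat_mult)
    moreover have "(sqrt 3) ^ 4 = (9::real)" by (simp add: power4_eq_xxxx)
    ultimately show ?thesis
      unfolding H std_normal_density_def c_def by (simp add: power_mult_distrib power_divide)
  qed
  define B where "B = (\<integral>y. \<bar>w y\<bar> \<partial>lborel)"
  have bh: "\<bar>h s\<bar> \<le> B" for s
    unfolding h_def using abs_integral_bounded_mult_le[OF w, of "\<lambda>y. exp (- (s - 2 * y)\<^sup>2 / 4)" 1] by (simp add: B_def)
  have bH: "\<bar>H s\<bar> \<le> sqrt 3 / 2 * B" for s
    unfolding H_def abs_mult using abs_integral_bounded_mult_le[OF w, of "\<lambda>y. exp (- 3 / 16 * (s / sqrt 3 - 2 * y)\<^sup>2)" 1] by (simp add: B_def)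
  have "\<bar>(h s)\<^sup>2\<bar> \<le> B\<^sup>2" for s using power_mono[OF bh[of s], of 2] by simp
  then have inth: "integrable lborel (\<lambda>s. std_normal_density s * (h s)\<^sup>2)"
    by (intro integrable_std_normal_mult_bounded[where B = "B\<^sup>2"]) auto
  have "\<bar>H s ^ 4\<bar> \<le> (sqrt 3 / 2 * B) ^ 4" for s using power_mono[OF bH[of s], of 4] by (simp add: power_abs)
  then have intH: "integrable lborel (\<lambda>s. std_normal_density s * H s ^ 4)"
    by (intro integrable_std_normal_mult_bounded[where B = "(sqrt 3 / 2 * B) ^ 4"]) auto
  \<comment> \<open>The 9/16 in \<open>\<gamma>H\<close> is the fourth power of sqrt 3 / 2; undoing
    the dilation by sqrt 3 / 2 inside u contributes one more such factor.\<close>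
  let ?I = "\<integral>\<^sup>+s. ennreal (u (sqrt 3 / 2 * s) ^ 4) \<partial>lborel"
  have "ennreal (c * 9 / 16) * ?I = (\<integral>\<^sup>+s. ennreal (std_normal_density s * H s ^ 4) \<partial>lborel)"
    unfolding \<gamma>H using c u0 by (subst nn_integral_cmult[symmetric]) (auto simp: ennreal_mult''[symmetric])
  also have "\<dots> = ennreal (\<integral>s. std_normal_density s * H s ^ 4 \<partial>lborel)"
    by (rule nn_integral_eq_integral[OF intH]) simp
  also have "\<dots> \<le> ennreal ((\<integral>s. std_normal_density s * (h s)\<^sup>2 \<partial>lborel)\<^sup>2)"
    using gaussian_hypercontractivity[OF w] by (intro ennreal_leI) (simp add: h_def H_def)
  also have "\<dots> = (ennreal (\<integral>s. std_normal_density s * (h s)\<^sup>2 \<partial>lborel))\<^sup>2"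
    by (subst ennreal_power) (auto intro: integral_nonneg_AE)
  also have "ennreal (\<integral>s. std_normal_density s * (h s)\<^sup>2 \<partial>lborel)
      = (\<integral>\<^sup>+s. ennreal (std_normal_density s * (h s)\<^sup>2) \<partial>lborel)"
    by (rule nn_integral_eq_integral[OF inth, symmetric]) simp
  also have "\<dots> = ennreal c * (\<integral>\<^sup>+s. (ennreal (\<phi> s))\<^sup>2 \<partial>lborel)"
  proof -
    have "0 \<le> \<phi> s" for s unfolding \<phi>_def using f by (intro integral_nonneg_AE) auto
    then show ?thesis unfolding \<gamma>h using c
      by (subst nn_integral_cmult[symmetric]) (auto simp: ennreal_mult'' ennreal_power)
  qed
  also have "(\<integral>\<^sup>+s. (ennreal (\<phi> s))\<^sup>2 \<partial>lborel) = ennreal (sqrt pi) * ?Q"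
    unfolding \<phi>_def using nn_integral_gaussian_square[OF meas f]
    by (subst ennreal_gaussian_mixture[OF int f]) auto
  finally have *: "ennreal (c * 9 / 16) * ?I \<le> (ennreal c * (ennreal (sqrt pi) * ?Q))\<^sup>2" .
  have "?lhs = (\<integral>\<^sup>+x. ennreal (u x ^ 4) \<partial>lborel)" by (simp add: u_def)
  also have "\<dots> = ennreal (sqrt 3 / 2) * ?I"
    by (subst nn_integral_real_affine[where c = "sqrt 3 / 2" and t = 0]) auto
  also have "ennreal (sqrt 3 / 2) = ennreal (sqrt 3 / 2 / (c * 9 / 16)) * ennreal (c * 9 / 16)"
    using c by (subst ennreal_mult'[symmetric]) auto
  also have "\<dots> * ?I \<le> ennreal (sqrt 3 / 2 / (c * 9 / 16)) * (ennreal c * (ennreal (sqrt pi) * ?Q))\<^sup>2"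
    unfolding mult.assoc by (rule mult_left_mono[OF *]) simp
  also have "\<dots> = ennreal (sqrt 3 / 2 / (c * 9 / 16) * c\<^sup>2 * pi) * ?Q\<^sup>2"
  proof -
    have "ennreal k * (ennreal c * (ennreal (sqrt pi) * q))\<^sup>2 = ennreal (k * c\<^sup>2 * pi) * q\<^sup>2"
      if "0 \<le> k" for k q
      using c that by (simp add: power_mult_distrib ennreal_mult ennreal_power mult.assoc)
    then show ?thesis using c by simp
  qed
  also have "sqrt 3 / 2 / (c * 9 / 16) * c\<^sup>2 * pi = smoothing_const"
  proof -
    have "c * pi = sqrt (2 * pi) / 2"
      unfolding c_def by (simp add: real_sqrt_mult field_simps)
    moreover have "sqrt 3 / 2 / (c * 9 / 16) * c\<^sup>2 * pi = 8 * sqrt 3 / 9 * (c * pi)"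
      using c by (simp add: field_simps power2_eq_square)
    ultimately have "sqrt 3 / 2 / (c * 9 / 16) * c\<^sup>2 * pi = 8 * sqrt 3 / 9 * (sqrt (2 * pi) / 2)"
      by (simp only:)
    then show ?thesis by (simp add: smoothing_const_def)
  qed
  finally show ?thesis .
qed

text \<open>Truncation to [-n, n] gives compact support. The smoothed truncations converge pointwise
  by dominated convergence, so Fatou's lemma handles the left side, while the right side for a
  truncation is at most that for f because everything is nonnegative.\<close>

lemma smoothing_nonneg:
  fixes f :: "real \<Rightarrow> real"
  assumes int: "integrable lborel f" and f: "\<And>y. 0 \<le> f y"
  shows "(\<integral>\<^sup>+x. ennreal ((\<integral>y. f y * exp (- (x - y)\<^sup>2 / 4) \<partial>lborel) ^ 4) \<partial>lborel)
    \<le> ennreal smoothing_const *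
      (\<integral>\<^sup>+x. ennreal (f x) * (\<integral>\<^sup>+y. ennreal (f y) * ennreal (exp (- (x - y)\<^sup>2 / 4)) \<partial>lborel) \<partial>lborel)\<^sup>2"
    (is "_ \<le> _ * ?Q\<^sup>2")
proof -
  have meas [measurable]: "f \<in> borel_measurable borel" using int by auto
  define F where "F = (\<lambda>n y. f y * indicator {- real n..real n} y)"
  have F: "integrable lborel (F n)" "0 \<le> F n y" "F n y \<le> f y" for n y
    using int f by (auto simp: F_def intro!: integrable_real_mult_indicator split: split_indicator)
  have [measurable]: "F n \<in> borel_measurable borel" for n unfolding F_def by measurable
  let ?u = "\<lambda>f x. \<integral>y. f y * exp (- (x - y)\<^sup>2 / 4) \<partial>lborel"
  have lim: "(\<lambda>n. ennreal (?u (F n) x ^ 4)) \<longlonglongrightarrow> ennreal (?u f x ^ 4)" for x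
  proof (intro tendsto_ennrealI tendsto_power integral_dominated_convergence)
    show "AE y in lborel. (\<lambda>n. F n y * exp (- (x - y)\<^sup>2 / 4)) \<longlonglongrightarrow> f y * exp (- (x - y)\<^sup>2 / 4)"
    proof (intro AE_I2 tendsto_mult tendsto_const)
      fix y :: real
      obtain N where N: "\<bar>y\<bar> \<le> real N" using real_arch_simple by blast
      have "eventually (\<lambda>n. f y = F n y) sequentially"
        using eventually_ge_at_top[of N] by eventually_elim (use N in \<open>auto simp: F_def indicator_def\<close>)
      then show "(\<lambda>n. F n y) \<longlonglongrightarrow> f y" by (rule Lim_transform_eventually[OF tendsto_const])
    qed
    show "AE y in lborel. norm (F n y * exp (- (x - y)\<^sup>2 / 4)) \<le> f y" for n
      using F f by (auto simp: abs_mult intro!: AE_I2 mult_le_one order_trans[OF mult_left_le F(3)])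
  qed (use int in measurable)
  have bound: "(\<integral>\<^sup>+x. ennreal (?u (F n) x ^ 4) \<partial>lborel) \<le> ennreal smoothing_const * ?Q\<^sup>2" for n
  proof -
    have "(\<integral>\<^sup>+x. ennreal (?u (F n) x ^ 4) \<partial>lborel)
      \<le> ennreal smoothing_const *
       (\<integral>\<^sup>+x. ennreal (F n x) * (\<integral>\<^sup>+y. ennreal (F n y) * ennreal (exp (- (x - y)\<^sup>2 / 4)) \<partial>lborel) \<partial>lborel)\<^sup>2"
      by (rule smoothing_compact_support[where R = "real n"]) (use F in \<open>auto simp: F_def indicator_def\<close>)
    also have "\<dots> \<le> ennreal smoothing_const * ?Q\<^sup>2"
      by (intro mult_left_mono power_mono nn_integral_mono mult_mono ennreal_leI F) auto
    finally show ?thesis .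
  qed
  have "(\<integral>\<^sup>+x. ennreal (?u f x ^ 4) \<partial>lborel)
      = (\<integral>\<^sup>+x. liminf (\<lambda>n. ennreal (?u (F n) x ^ 4)) \<partial>lborel)"
    by (intro nn_integral_cong lim_imp_Liminf[symmetric] lim) simp
  also have "\<dots> \<le> liminf (\<lambda>n. \<integral>\<^sup>+x. ennreal (?u (F n) x ^ 4) \<partial>lborel)"
    by (rule nn_integral_liminf) measurable
  also have "\<dots> \<le> liminf (\<lambda>n. ennreal smoothing_const * ?Q\<^sup>2)"
    by (intro Liminf_mono always_eventually allI bound)
  also have "\<dots> = ennreal smoothing_const * ?Q\<^sup>2" by (simp add: Liminf_const)
  finally show ?thesis .
qed

lemma gaussian_energy_bound:
  fixes f :: "real \<Rightarrow> real"
  assumes int: "integrable lborel f" "integrable lborel (\<lambda>x. (f x)\<^sup>2)" and f: "\<And>y. 0 \<le> f y"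
  shows "(\<integral>\<^sup>+x. ennreal (f x) * (\<integral>\<^sup>+y. ennreal (f y) * ennreal (exp (- (x - y)\<^sup>2 / 4)) \<partial>lborel) \<partial>lborel)
    \<le> ennreal (sqrt (smoothing_const * (\<integral>x. f x \<partial>lborel)\<^sup>2 * (\<integral>x. (f x)\<^sup>2 \<partial>lborel)))"
    (is "?Q \<le> _")
proof -
  have meas [measurable]: "f \<in> borel_measurable borel" using int by auto
  define M N where "M = (\<integral>x. f x \<partial>lborel)" and "N = (\<integral>x. (f x)\<^sup>2 \<partial>lborel)"
  have MN: "0 \<le> M" "0 \<le> N" unfolding M_def N_def using f by (auto intro: integral_nonneg_AE)
  have M: "(\<integral>\<^sup>+x. ennreal (f x) \<partial>lborel) = ennreal M"
    and N: "(\<integral>\<^sup>+x. (ennreal (f x))\<^sup>2 \<partial>lborel) = ennreal N"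
    unfolding M_def N_def using int f by (simp_all add: nn_integral_eq_integral ennreal_power)
  define u where "u = (\<lambda>x. \<integral>y. f y * exp (- (x - y)\<^sup>2 / 4) \<partial>lborel)"
  have [measurable]: "u \<in> borel_measurable borel" unfolding u_def by measurable
  have u0: "0 \<le> u x" for x unfolding u_def using f by (intro integral_nonneg_AE) auto
  have uM: "u x \<le> M" for x
    using abs_integral_bounded_mult_le[OF int(1), of "\<lambda>y. exp (- (x - y)\<^sup>2 / 4)" 1] f
    by (simp add: u_def M_def)
  have Q: "?Q = (\<integral>\<^sup>+x. ennreal (f x * u x) \<partial>lborel)"
    unfolding u_def using f u0[unfolded u_def]
    by (simp add: ennreal_mult ennreal_gaussian_mixture[OF int(1) f])
  \<comment> \<open>The kernel is at most 1, so u \<le> M and Q \<le> M^2. This finiteness is what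
    later allows q^2 to be cancelled from q^4 \<le> K q^2.\<close>
  have "?Q \<le> (\<integral>\<^sup>+x. ennreal M * ennreal (f x) \<partial>lborel)"
    unfolding Q using f uM u0 MN
    by (intro nn_integral_mono) (auto simp: ennreal_mult[symmetric] mult.commute[of M] intro!: ennreal_leI mult_left_mono)
  also have "\<dots> = ennreal (M * M)" using MN by (simp add: nn_integral_cmult M ennreal_mult)
  finally have "?Q < \<top>" using ennreal_less_top order_le_less_trans by blast
  then obtain q where q: "?Q = ennreal q" "0 \<le> q" by (cases ?Q) auto
  \<comment> \<open>Splitting f u as sqrt f times sqrt f u makes the first Cauchy-Schwarz factor
    exactly the L^1 norm.\<close>
  have "?Q\<^sup>2 = (\<integral>\<^sup>+x. ennreal (sqrt (f x)) * ennreal (sqrt (f x) * u x) \<partial>lborel)\<^sup>2"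
    unfolding Q using f u0 by (simp add: ennreal_mult[symmetric] mult.assoc[symmetric])
  also have "\<dots> \<le> (\<integral>\<^sup>+x. (ennreal (sqrt (f x)))\<^sup>2 \<partial>lborel) * (\<integral>\<^sup>+x. (ennreal (sqrt (f x) * u x))\<^sup>2 \<partial>lborel)"
    by (rule Cauchy_Schwarz_nn_integral) measurable
  also have "\<dots> = ennreal M * (\<integral>\<^sup>+x. ennreal (f x) * ennreal ((u x)\<^sup>2) \<partial>lborel)"
    using f u0 by (simp add: ennreal_power power_mult_distrib ennreal_mult M)
  finally have "(?Q\<^sup>2)\<^sup>2 \<le> (ennreal M * (\<integral>\<^sup>+x. ennreal (f x) * ennreal ((u x)\<^sup>2) \<partial>lborel))\<^sup>2"
    by (rule power_mono) simp
  also have "\<dots> = (ennreal M)\<^sup>2 * (\<integral>\<^sup>+x. ennreal (f x) * ennreal ((u x)\<^sup>2) \<partial>lborel)\<^sup>2"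
    by (simp add: power_mult_distrib)
  also have "\<dots> \<le> (ennreal M)\<^sup>2 * ((\<integral>\<^sup>+x. (ennreal (f x))\<^sup>2 \<partial>lborel) * (\<integral>\<^sup>+x. (ennreal ((u x)\<^sup>2))\<^sup>2 \<partial>lborel))"
    by (intro mult_left_mono Cauchy_Schwarz_nn_integral) auto
  also have "(\<integral>\<^sup>+x. (ennreal ((u x)\<^sup>2))\<^sup>2 \<partial>lborel) = (\<integral>\<^sup>+x. ennreal (u x ^ 4) \<partial>lborel)"
    by (simp add: ennreal_power flip: power_mult)
  also have "(ennreal M)\<^sup>2 * ((\<integral>\<^sup>+x. (ennreal (f x))\<^sup>2 \<partial>lborel) * \<dots>)
      \<le> (ennreal M)\<^sup>2 * (ennreal N * (ennreal smoothing_const * ?Q\<^sup>2))"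
    unfolding N using smoothing_nonneg[OF int(1) f] by (intro mult_left_mono) (auto simp: u_def)
  also have "\<dots> = ennreal (M\<^sup>2 * (N * (smoothing_const * q\<^sup>2)))"
    unfolding q(1) using MN q smoothing_const_pos by (simp add: ennreal_mult ennreal_power)
  also have "(?Q\<^sup>2)\<^sup>2 = ennreal (q ^ 4)"
    unfolding q(1) using q by (simp add: ennreal_power flip: power_mult)
  finally have "q ^ 4 \<le> M\<^sup>2 * (N * (smoothing_const * q\<^sup>2))"
    using MN q smoothing_const_pos by (subst (asm) ennreal_le_iff) auto
  then have "q\<^sup>2 * q\<^sup>2 \<le> (smoothing_const * M\<^sup>2 * N) * q\<^sup>2"
    by (simp add: power4_eq_xxxx power2_eq_square mult_ac)
  then have "q\<^sup>2 \<le> smoothing_const * M\<^sup>2 * N"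
    using MN smoothing_const_pos mult_right_le_imp_le[of "q\<^sup>2" "q\<^sup>2"] by (cases "q = 0") auto
  then have "q \<le> sqrt (smoothing_const * M\<^sup>2 * N)"
    using real_le_rsqrt by blast
  then show ?thesis unfolding q(1) M_def N_def by (rule ennreal_leI)
qed

text \<open>The dilation by r with a r^2 = 1/4 reduces to the previous kernel. Both integrals of f
  get divided by r and the double integral gains r^2, so under the root r^4 / r^3 leaves a single
  factor r = 1 / (2 sqrt a).\<close>

lemma gaussian_energy_bound_scaled:
  fixes f :: "real \<Rightarrow> real" and a :: real
  assumes a: "a > 0"
    and int: "integrable lborel f" "integrable lborel (\<lambda>x. (f x)\<^sup>2)" and f: "\<And>y. 0 \<le> f y"
  shows "(\<integral>\<^sup>+x. ennreal (f x) * (\<integral>\<^sup>+y. ennreal (f y) * ennreal (exp (- a * (x - y)\<^sup>2)) \<partial>lborel) \<partial>lborel)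
    \<le> ennreal (sqrt (smoothing_const * (1 / (2 * sqrt a)) * (\<integral>x. f x \<partial>lborel)\<^sup>2 * (\<integral>x. (f x)\<^sup>2 \<partial>lborel)))"
proof -
  define r where "r = 1 / (2 * sqrt a)"
  have r: "r > 0" "a * r\<^sup>2 = 1 / 4" using a by (simp_all add: r_def power_divide power_mult_distrib)
  define F where "F = (\<lambda>x. f (r * x))"
  define M N where "M = (\<integral>x. f x \<partial>lborel)" and "N = (\<integral>x. (f x)\<^sup>2 \<partial>lborel)"
  have [measurable]: "f \<in> borel_measurable borel" using int by auto
  have [measurable]: "F \<in> borel_measurable borel" unfolding F_def by measurable
  have intF: "integrable lborel F" "integrable lborel (\<lambda>x. (F x)\<^sup>2)"
    unfolding F_def using lborel_integrable_real_affine[OF int(1), of r 0]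
      lborel_integrable_real_affine[OF int(2), of r 0] r by simp_all
  have MF: "(\<integral>x. F x \<partial>lborel) = M / r" and NF: "(\<integral>x. (F x)\<^sup>2 \<partial>lborel) = N / r"
    unfolding F_def M_def N_def using r lborel_integral_real_affine[of r f 0]
      lborel_integral_real_affine[of r "\<lambda>x. (f x)\<^sup>2" 0] by simp_all
  let ?G = "\<lambda>f x. \<integral>\<^sup>+y. ennreal (f y) * ennreal (exp (- a * (x - y)\<^sup>2)) \<partial>lborel"
  have G: "?G f (r * x) = r * (\<integral>\<^sup>+y. ennreal (F y) * ennreal (exp (- (x - y)\<^sup>2 / 4)) \<partial>lborel)" for x
  proof -
    have "- a * (r * x - r * y)\<^sup>2 = - (x - y)\<^sup>2 / 4" for y
    proof -
      have "- a * (r * x - r * y)\<^sup>2 = - (a * r\<^sup>2) * (x - y)\<^sup>2"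
        by (simp only: right_diff_distrib[symmetric] power_mult_distrib) simp
      then show ?thesis unfolding r(2) by simp
    qed
    then have E: "exp (- (a * (r * x - r * y)\<^sup>2)) = exp (- ((x - y)\<^sup>2 / 4))" for y
      by simp
    show ?thesis
      unfolding F_def using r(1) by (subst nn_integral_real_affine[where c = r and t = 0]) (auto simp: E)
  qed
  have "(\<integral>\<^sup>+x. ennreal (f x) * ?G f x \<partial>lborel) = r * (\<integral>\<^sup>+x. ennreal (F x) * ?G f (r * x) \<partial>lborel)"
    unfolding F_def using r by (subst nn_integral_real_affine[where c = r and t = 0]) auto
  also have "\<dots> = r * (\<integral>\<^sup>+x. ennreal (F x) * (r * (\<integral>\<^sup>+y. ennreal (F y) * ennreal (exp (- (x - y)\<^sup>2 / 4)) \<partial>lborel)) \<partial>lborel)"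
    by (simp only: G)
  also have "r * (\<integral>\<^sup>+x. ennreal (F x) * (r * (\<integral>\<^sup>+y. ennreal (F y) * ennreal (exp (- (x - y)\<^sup>2 / 4)) \<partial>lborel)) \<partial>lborel)
      = ennreal (r\<^sup>2) * (\<integral>\<^sup>+x. ennreal (F x) * (\<integral>\<^sup>+y. ennreal (F y) * ennreal (exp (- (x - y)\<^sup>2 / 4)) \<partial>lborel) \<partial>lborel)"
    unfolding mult.left_commute[of "ennreal (F _)"] using r
    by (subst nn_integral_cmult) (auto simp: ennreal_mult power2_eq_square mult.assoc)
  also have "\<dots> \<le> ennreal (r\<^sup>2) * ennreal (sqrt (smoothing_const * (M / r)\<^sup>2 * (N / r)))"
    using gaussian_energy_bound[OF intF] f by (intro mult_left_mono) (auto simp: F_def MF[unfolded F_def] NF[unfolded F_def])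
  also have "\<dots> = ennreal (sqrt ((r\<^sup>2)\<^sup>2 * (smoothing_const * (M / r)\<^sup>2 * (N / r))))"
  proof -
    have "sqrt ((r\<^sup>2)\<^sup>2 * X) = r\<^sup>2 * sqrt X" for X unfolding real_sqrt_mult real_sqrt_abs by simp
    then show ?thesis by (simp only: ennreal_mult' zero_le_power2)
  qed
  also have "(r\<^sup>2)\<^sup>2 * (smoothing_const * (M / r)\<^sup>2 * (N / r)) = smoothing_const * r * M\<^sup>2 * N"
    using r by (simp add: power2_eq_square field_simps)
  finally show ?thesis unfolding r_def M_def N_def .
qed

section \<open>The inequality in Lebesgue spaces\<close>

lemma powr_quarter: "0 \<le> x \<Longrightarrow> x powr (1/4) = sqrt (sqrt x)" for x :: real
  by (simp add: powr_half_sqrt[symmetric] powr_powr)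

lemma Lp_norm_1: "Lp_norm 1 f = (\<integral>x. \<bar>f x\<bar> \<partial>lebesgue)"
  by (simp add: Lp_norm_def)

lemma Lp_norm_2: "Lp_norm 2 f = sqrt (\<integral>x. (f x)\<^sup>2 \<partial>lebesgue)"
  by (simp add: Lp_norm_def powr_half_sqrt)

lemma Lp_space_1_2_iff: "f \<in> Lp_space 1 \<inter> Lp_space 2 \<longleftrightarrow>
  f \<in> borel_measurable lebesgue \<and> integrable lebesgue (\<lambda>x. \<bar>f x\<bar>) \<and> integrable lebesgue (\<lambda>x. (f x)\<^sup>2)"
  by (auto simp: Lp_space_def)

lemma measurable_lebesgue_shift: "(\<lambda>x::real. x + t) \<in> lebesgue \<rightarrow>\<^sub>M lebesgue"
  using lebesgue_affine_measurable[where c = "\<lambda>x::real. 1" and t = t] by (simp add: add.commute)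

lemma AE_lborel_shift:
  assumes "AE x in lborel. P (x::real)"
  shows "AE x in lborel. P (x + t)"
proof -
  obtain N where N: "{x. \<not> P x} \<subseteq> N" "N \<in> null_sets lborel"
    using assms by (auto elim!: AE_E simp: null_sets_def)
  then have [measurable]: "N \<in> sets borel" by (auto simp: null_sets_def)
  have "AE x in lborel. t + 1 * x \<notin> N"
    using N by (intro AE_borel_affine) (auto intro: AE_not_in)
  then show ?thesis by eventually_elim (use N in \<open>auto simp: add.commute\<close>)
qed

text \<open>Passing to \<open>\<bar>g\<bar>\<close> makes everything nonnegative, so Tonelli and the
  substitution y = x + t turn the correlation into the energy already bounded. For each t the
  product of \<open>\<bar>g\<bar>\<close> and its translate is integrable because g is square
  integrable.\<close>

lemma gaussian_correlation_le:
  fixes g :: "real \<Rightarrow> real" and a :: real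
  assumes a: "a > 0" and [measurable]: "g \<in> borel_measurable borel"
    and int: "integrable lborel (\<lambda>x. \<bar>g x\<bar>)" "integrable lborel (\<lambda>x. (g x)\<^sup>2)"
  shows "(\<integral>t. (\<integral>x. g x * g (x + t) * exp (- a * t\<^sup>2) \<partial>lborel) \<partial>lborel)
    \<le> sqrt (smoothing_const * (1 / (2 * sqrt a)) * (\<integral>x. \<bar>g x\<bar> \<partial>lborel)\<^sup>2 * (\<integral>x. (g x)\<^sup>2 \<partial>lborel))"
    (is "?L \<le> ?C")
proof -
  define G where "G = (\<lambda>x. \<bar>g x\<bar>)"
  have [measurable]: "G \<in> borel_measurable borel" unfolding G_def by measurable
  have prod: "integrable lborel (\<lambda>x. G x * G (x + t))" for t
  proof (rule Bochner_Integration.integrable_bound)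
    have "integrable lborel (\<lambda>x. (g (t + 1 * x))\<^sup>2)"
      using int(2) by (rule lborel_integrable_real_affine) simp
    then show "integrable lborel (\<lambda>x. (g x)\<^sup>2 + (g (x + t))\<^sup>2)"
      using int(2) by (simp add: add.commute)
    have "\<bar>x\<bar> * \<bar>y\<bar> \<le> x\<^sup>2 + y\<^sup>2" for x y :: real
    proof -
      have "2 * (\<bar>x\<bar> * \<bar>y\<bar>) \<le> x\<^sup>2 + y\<^sup>2"
        using sum_squares_bound[of "\<bar>x\<bar>" "\<bar>y\<bar>"] by simp
      moreover have "0 \<le> \<bar>x\<bar> * \<bar>y\<bar>" by simp
      ultimately show ?thesis by linarith
    qed
    then show "AE x in lborel. norm (G x * G (x + t)) \<le> norm ((g x)\<^sup>2 + (g (x + t))\<^sup>2)"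
      by (auto simp: G_def abs_mult)
  qed measurable
  define A where "A = (\<lambda>t. exp (- a * t\<^sup>2) * (\<integral>x. G x * G (x + t) \<partial>lborel))"
  have [measurable]: "A \<in> borel_measurable borel" unfolding A_def by measurable
  have A0: "0 \<le> A t" for t unfolding A_def G_def by simp
  have "(\<integral>\<^sup>+t. ennreal (A t) \<partial>lborel)
      = (\<integral>\<^sup>+t. \<integral>\<^sup>+x. ennreal (G x) * (ennreal (G (x + t)) * ennreal (exp (- a * t\<^sup>2))) \<partial>lborel \<partial>lborel)"
  proof (intro nn_integral_cong)
    fix t
    have "ennreal (A t) = ennreal (exp (- a * t\<^sup>2)) * (\<integral>\<^sup>+x. ennreal (G x * G (x + t)) \<partial>lborel)"
      unfolding A_def using prod[of t]
      by (subst nn_integral_eq_integral) (auto simp: ennreal_mult' G_def)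
    also have "\<dots> = (\<integral>\<^sup>+x. ennreal (exp (- a * t\<^sup>2)) * ennreal (G x * G (x + t)) \<partial>lborel)"
      by (rule nn_integral_cmult[symmetric]) measurable
    also have "\<dots> = (\<integral>\<^sup>+x. ennreal (G x) * (ennreal (G (x + t)) * ennreal (exp (- a * t\<^sup>2))) \<partial>lborel)"
      by (intro nn_integral_cong) (simp add: ennreal_mult G_def mult_ac)
    finally show "ennreal (A t) = \<dots>" .
  qed
  also have "\<dots> = (\<integral>\<^sup>+x. \<integral>\<^sup>+t. ennreal (G x) * (ennreal (G (x + t)) * ennreal (exp (- a * t\<^sup>2))) \<partial>lborel \<partial>lborel)"
    by (rule lborel_pair.Fubini') measurable
  also have "\<dots> = (\<integral>\<^sup>+x. ennreal (G x) * (\<integral>\<^sup>+y. ennreal (G y) * ennreal (exp (- a * (x - y)\<^sup>2)) \<partial>lborel) \<partial>lborel)"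
  proof (intro nn_integral_cong)
    fix x
    have "(\<integral>\<^sup>+y. ennreal (G y) * ennreal (exp (- a * (x - y)\<^sup>2)) \<partial>lborel)
        = (\<integral>\<^sup>+t. ennreal (G (x + t)) * ennreal (exp (- a * t\<^sup>2)) \<partial>lborel)"
      by (subst nn_integral_real_affine[where c = 1 and t = x]) auto
    then show "(\<integral>\<^sup>+t. ennreal (G x) * (ennreal (G (x + t)) * ennreal (exp (- a * t\<^sup>2))) \<partial>lborel)
        = ennreal (G x) * (\<integral>\<^sup>+y. ennreal (G y) * ennreal (exp (- a * (x - y)\<^sup>2)) \<partial>lborel)"
      by (simp add: nn_integral_cmult)
  qed
  also have "\<dots> \<le> ennreal ?C"
    using gaussian_energy_bound_scaled[OF a, of G] int by (simp add: G_def)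
  finally have nn: "(\<integral>\<^sup>+t. ennreal (A t) \<partial>lborel) \<le> ennreal ?C" .
  have C0: "0 \<le> ?C" using smoothing_const_pos a by (simp add: integral_nonneg_AE)
  have intA: "integrable lborel A"
    using nn A0 by (intro integrableI_bounded) (auto simp: order_le_less_trans[OF _ ennreal_less_top])
  \<comment> \<open>Only the majorant \<open>A\<close> is shown integrable: an outer integrand
    without an integral would contribute the default value 0, still below the integral of
    \<open>A\<close>.\<close>
  have "(\<integral>t. (\<integral>x. g x * g (x + t) * exp (- a * t\<^sup>2) \<partial>lborel) \<partial>lborel) \<le> (\<integral>t. A t \<partial>lborel)"
  proof (rule integral_mono'[OF intA _ A0])
    fix t
    have "\<bar>\<integral>x. g x * g (x + t) \<partial>lborel\<bar> \<le> (\<integral>x. G x * G (x + t) \<partial>lborel)"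
      using integral_abs_bound[of lborel "\<lambda>x. g x * g (x + t)"] by (simp add: G_def abs_mult)
    then have "(\<integral>x. g x * g (x + t) \<partial>lborel) * exp (- a * t\<^sup>2) \<le> (\<integral>x. G x * G (x + t) \<partial>lborel) * exp (- a * t\<^sup>2)"
      by (intro mult_right_mono) auto
    then show "(\<integral>x. g x * g (x + t) * exp (- a * t\<^sup>2) \<partial>lborel) \<le> A t"
      by (simp add: A_def mult.commute)
  qed
  also have "\<dots> \<le> ?C"
    using nn C0 A0 intA by (subst (asm) nn_integral_eq_integral) (auto simp: ennreal_le_iff)
  finally show ?thesis .
qed

text \<open>A Borel function g equal to f almost everywhere takes its place, so that product
  measurability and Tonelli apply. Translation preserves null sets, hence the inner integrals agree
  for every t.\<close>

lemma gaussian_correlation_Lp_bound: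
  fixes a :: real
  assumes a: "a > 0" and f: "f \<in> Lp_space 1 \<inter> Lp_space 2"
  shows "(a / pi) powr (1/2) *
      (\<integral>t. (\<integral>x. f x * f (x + t) * exp (- a * t\<^sup>2) \<partial>lebesgue) \<partial>lebesgue)
    \<le> (8 * a / (27 * pi)) powr (1/4) * Lp_norm 1 f * Lp_norm 2 f"
proof -
  have f_meas [measurable]: "f \<in> borel_measurable lebesgue"
    and f1: "integrable lebesgue (\<lambda>x. \<bar>f x\<bar>)" and f2: "integrable lebesgue (\<lambda>x. (f x)\<^sup>2)"
    using f unfolding Lp_space_1_2_iff by auto
  obtain g where g [measurable]: "g \<in> borel_measurable borel" and fg: "AE x in lborel. f x = g x"
    using completion_ex_borel_measurable_real[OF f_meas] by auto
  have g_leb [measurable]: "g \<in> borel_measurable lebesgue" using g by (simp add: measurable_completion)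
  have fg': "AE x in lebesgue. f x = g x" using fg by (rule AE_completion)
  have "integrable lebesgue (\<lambda>x. \<bar>g x\<bar>)"
    using f1 fg' by (subst integrable_cong_AE[where g = "\<lambda>x. \<bar>f x\<bar>"]) auto
  then have g1: "integrable lborel (\<lambda>x. \<bar>g x\<bar>)" by (subst (asm) integrable_completion) auto
  have "integrable lebesgue (\<lambda>x. (g x)\<^sup>2)"
    using f2 fg' by (subst integrable_cong_AE[where g = "\<lambda>x. (f x)\<^sup>2"]) auto
  then have g2: "integrable lborel (\<lambda>x. (g x)\<^sup>2)" by (subst (asm) integrable_completion) auto
  define M N where "M = (\<integral>x. \<bar>g x\<bar> \<partial>lborel)" and "N = (\<integral>x. (g x)\<^sup>2 \<partial>lborel)"
  have MN: "0 \<le> M" "0 \<le> N" by (simp_all add: M_def N_def)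
  have "Lp_norm 1 f = (\<integral>x. \<bar>g x\<bar> \<partial>lebesgue)"
    unfolding Lp_norm_1 using fg' by (intro integral_cong_AE) auto
  then have norm1: "Lp_norm 1 f = M" by (simp add: integral_completion M_def)
  have "Lp_norm 2 f = sqrt (\<integral>x. (g x)\<^sup>2 \<partial>lebesgue)"
    unfolding Lp_norm_2 using fg' by (intro arg_cong[where f = sqrt] integral_cong_AE) auto
  then have norm2: "Lp_norm 2 f = sqrt N" by (simp add: integral_completion N_def)
  have inner: "(\<integral>x. f x * f (x + t) * exp (- a * t\<^sup>2) \<partial>lebesgue)
      = (\<integral>x. g x * g (x + t) * exp (- a * t\<^sup>2) \<partial>lborel)" for t
  proof -
    have [measurable]: "(\<lambda>x. f (x + t)) \<in> borel_measurable lebesgue"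
      using measurable_compose[OF measurable_lebesgue_shift f_meas] .
    have [measurable]: "(\<lambda>x. g (x + t)) \<in> borel_measurable lebesgue"
      using measurable_compose[OF measurable_lebesgue_shift g_leb] .
    have "AE x in lebesgue. f (x + t) = g (x + t)" using AE_lborel_shift[OF fg] by (rule AE_completion)
    with fg' have "AE x in lebesgue. f x * f (x + t) * exp (- a * t\<^sup>2) = g x * g (x + t) * exp (- a * t\<^sup>2)"
      by eventually_elim simp
    then have "(\<integral>x. f x * f (x + t) * exp (- a * t\<^sup>2) \<partial>lebesgue)
        = (\<integral>x. g x * g (x + t) * exp (- a * t\<^sup>2) \<partial>lebesgue)"
      by (intro integral_cong_AE) measurable
    then show ?thesis by (simp add: integral_completion)
  qed
  define r where "r = 1 / (2 * sqrt a)"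
  have r: "r > 0" using a by (simp add: r_def)
  have "(\<integral>t. (\<integral>x. f x * f (x + t) * exp (- a * t\<^sup>2) \<partial>lebesgue) \<partial>lebesgue)
      = (\<integral>t. (\<integral>x. g x * g (x + t) * exp (- a * t\<^sup>2) \<partial>lborel) \<partial>lborel)"
    unfolding inner by (rule integral_completion) measurable
  also have "\<dots> \<le> sqrt (smoothing_const * r * M\<^sup>2 * N)"
    unfolding r_def M_def N_def by (rule gaussian_correlation_le[OF a g g1 g2])
  also have "\<dots> = sqrt (smoothing_const * r) * M * sqrt N"
    using MN by (simp add: real_sqrt_mult)
  finally have "(a / pi) powr (1/2) *
      (\<integral>t. (\<integral>x. f x * f (x + t) * exp (- a * t\<^sup>2) \<partial>lebesgue) \<partial>lebesgue)
    \<le> sqrt (a / pi) * (sqrt (smoothing_const * r) * M * sqrt N)"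
    using a by (simp add: powr_half_sqrt mult_left_mono)
  also have "\<dots> = sqrt (a / pi * (smoothing_const * r)) * M * sqrt N"
    by (simp only: real_sqrt_mult[of "a / pi"] mult.assoc)
  \<comment> \<open>Squared, this is a^2 / pi^2 times 32 pi / 27 times 1 / (4 a).\<close>
  also have "a / pi * (smoothing_const * r) = sqrt (8 * a / (27 * pi))"
  proof (rule real_sqrt_unique[symmetric])
    show "(a / pi * (smoothing_const * r))\<^sup>2 = 8 * a / (27 * pi)"
      using a by (simp add: r_def smoothing_const_def power_mult_distrib power_divide field_simps)
        (simp add: power2_eq_square)
    show "0 \<le> a / pi * (smoothing_const * r)" using a r smoothing_const_pos by simp
  qed
  finally show ?thesis unfolding norm1 norm2 using a by (simp add: powr_quarter)
qed

section \<open>A flattened Gaussian\<close>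

lemma has_bochner_integral_gaussian_0:
  "c > 0 \<Longrightarrow> has_bochner_integral lborel (\<lambda>x. exp (- c * x\<^sup>2)) (sqrt (pi / c))" for c :: real
  using has_bochner_integral_gaussian[of c 0] by simp

text \<open>Completing the square in x about - q t / (p + q) leaves a Gaussian in t with parameter p
  q / (p + q).\<close>

lemma has_bochner_integral_gaussian_pair:
  fixes p q t a :: real
  assumes "p > 0" "q > 0"
  shows "has_bochner_integral lborel (\<lambda>x. exp (- p * x\<^sup>2) * exp (- q * (x + t)\<^sup>2) * exp (- a * t\<^sup>2))
    (sqrt (pi / (p + q)) * exp (- (p * q / (p + q) + a) * t\<^sup>2))"
proof -
  have "- p * x\<^sup>2 + - q * (x + t)\<^sup>2 + - a * t\<^sup>2
      = - (p + q) * (x - (- q * t / (p + q)))\<^sup>2 + - (p * q / (p + q) + a) * t\<^sup>2" for x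
    using assms by (simp add: power2_eq_square divide_simps) (simp add: algebra_simps)
  then have "exp (- p * x\<^sup>2) * exp (- q * (x + t)\<^sup>2) * exp (- a * t\<^sup>2)
      = exp (- (p + q) * (x - (- q * t / (p + q)))\<^sup>2) * exp (- (p * q / (p + q) + a) * t\<^sup>2)" for x
    by (simp only: exp_add[symmetric])
  moreover have "has_bochner_integral lborel (\<lambda>x. exp (- (p + q) * (x - (- q * t / (p + q)))\<^sup>2)) (sqrt (pi / (p + q)))"
    using assms by (intro has_bochner_integral_gaussian) simp
  ultimately show ?thesis
    using has_bochner_integral_mult_left[of "exp (- (p * q / (p + q) + a) * t\<^sup>2)"] by simp
qed

lemma has_bochner_integral_gaussian_pair_outer:
  fixes p q a :: real
  assumes "p > 0" "q > 0" "a > 0"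
  shows "has_bochner_integral lborel (\<lambda>t. sqrt (pi / (p + q)) * exp (- (p * q / (p + q) + a) * t\<^sup>2))
    (pi / sqrt (p * q + a * (p + q)))"
proof -
  have "has_bochner_integral lborel (\<lambda>t. sqrt (pi / (p + q)) * exp (- (p * q / (p + q) + a) * t\<^sup>2))
      (sqrt (pi / (p + q)) * sqrt (pi / (p * q / (p + q) + a)))"
    using assms by (intro has_bochner_integral_mult_right has_bochner_integral_gaussian_0) (simp add: add_pos_pos)
  also have "sqrt (pi / (p + q)) * sqrt (pi / (p * q / (p + q) + a)) = sqrt (pi\<^sup>2 / (p * q + a * (p + q)))"
  proof -
    have "p * q / (p + q) + a = (p * q + a * (p + q)) / (p + q)" using assms by (simp add: field_simps)
    moreover have "0 < p + q" using assms by simp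
    ultimately show ?thesis unfolding real_sqrt_mult[symmetric] by (simp add: power2_eq_square)
  qed
  also have "\<dots> = pi / sqrt (p * q + a * (p + q))"
    by (simp add: real_sqrt_divide)
  finally show ?thesis .
qed

text \<open>
  The function \<open>exp (- 2 a x\<^sup>2)\<close> alone gives equality with the constant \<open>(a / (4 \<pi>)) powr (1/4)\<close>.
  It is not a critical point of the quotient, and subtracting a small multiple of a narrower Gaussian
  increases it.
\<close>

lemma flattened_gaussian_exceeds:
  fixes a :: real
  assumes a: "a > 0"
  defines "f \<equiv> (\<lambda>x. exp (- (2 * a) * x\<^sup>2) - 1 / 5 * exp (- (8 * a) * x\<^sup>2))"
  shows "f \<in> Lp_space 1 \<inter> Lp_space 2"
    and "(a / (4 * pi)) powr (1/4) * Lp_norm 1 f * Lp_norm 2 f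
      < (a / pi) powr (1/2) *
        (\<integral>t. (\<integral>x. f x * f (x + t) * exp (- a * t\<^sup>2) \<partial>lebesgue) \<partial>lebesgue)"
proof -
  \<comment> \<open>D carries all dependence on a: each integral below is a power of D times a
    number, so the claim becomes one numerical inequality.\<close>
  define D where "D = sqrt (pi / a)"
  have D: "D > 0" "D\<^sup>2 = pi / a" using a by (simp_all add: D_def)
  have sqrt_pi_div: "sqrt (pi / (c * a)) = D / sqrt c" for c
    by (simp add: D_def real_sqrt_divide real_sqrt_mult)
  have [measurable]: "f \<in> borel_measurable borel" unfolding f_def by measurable
  have f0: "0 \<le> f x" for x
  proof -
    have "exp (- (8 * a) * x\<^sup>2) \<le> exp (- (2 * a) * x\<^sup>2)" using a by (simp add: mult_right_mono)
    moreover have "0 \<le> exp (- (8 * a) * x\<^sup>2)" by simp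
    ultimately show ?thesis unfolding f_def by linarith
  qed
  have "has_bochner_integral lborel f (sqrt (pi / (2 * a)) - 1 / 5 * sqrt (pi / (8 * a)))"
    unfolding f_def using a
    by (intro has_bochner_integral_diff has_bochner_integral_mult_right has_bochner_integral_gaussian_0) auto
  also have "sqrt (pi / (2 * a)) - 1 / 5 * sqrt (pi / (8 * a)) = D * (9 / (10 * sqrt 2))"
  proof -
    have "sqrt 8 = 2 * sqrt (2::real)" using real_sqrt_mult[of 4 2] by simp
    then show ?thesis unfolding sqrt_pi_div by (simp add: field_simps)
  qed
  finally have M: "has_bochner_integral lborel (\<lambda>x. \<bar>f x\<bar>) (D * (9 / (10 * sqrt 2)))"
    using f0 by simp
  have "(f x)\<^sup>2 = (exp (- (4 * a) * x\<^sup>2) - 2 / 5 * exp (- (10 * a) * x\<^sup>2)) + 1 / 25 * exp (- (16 * a) * x\<^sup>2)" for x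
  proof -
    have "exp (- (4 * a) * x\<^sup>2) = exp (- (2 * a) * x\<^sup>2) * exp (- (2 * a) * x\<^sup>2)"
      "exp (- (10 * a) * x\<^sup>2) = exp (- (2 * a) * x\<^sup>2) * exp (- (8 * a) * x\<^sup>2)"
      "exp (- (16 * a) * x\<^sup>2) = exp (- (8 * a) * x\<^sup>2) * exp (- (8 * a) * x\<^sup>2)"
      unfolding exp_add[symmetric] by (auto simp: algebra_simps)
    then show ?thesis unfolding f_def power2_diff by (simp add: power2_eq_square)
  qed
  moreover have "has_bochner_integral lborel
      (\<lambda>x. (exp (- (4 * a) * x\<^sup>2) - 2 / 5 * exp (- (10 * a) * x\<^sup>2)) + 1 / 25 * exp (- (16 * a) * x\<^sup>2))
      ((sqrt (pi / (4 * a)) - 2 / 5 * sqrt (pi / (10 * a))) + 1 / 25 * sqrt (pi / (16 * a)))"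
    using a by (intro has_bochner_integral_add has_bochner_integral_diff has_bochner_integral_mult_right
      has_bochner_integral_gaussian_0) auto
  moreover define n :: real where "n = 51 / 100 - 2 / (5 * sqrt 10)"
  moreover have "(sqrt (pi / (4 * a)) - 2 / 5 * sqrt (pi / (10 * a))) + 1 / 25 * sqrt (pi / (16 * a)) = D * n"
    unfolding sqrt_pi_div n_def by (simp add: field_simps)
  ultimately have N: "has_bochner_integral lborel (\<lambda>x. (f x)\<^sup>2) (D * n)" by simp
  show "f \<in> Lp_space 1 \<inter> Lp_space 2"
    unfolding Lp_space_1_2_iff using M N
    by (auto simp: integrable_completion measurable_completion dest: integrable.intros)
  have norm1: "Lp_norm 1 f = D * (9 / (10 * sqrt 2))"
    unfolding Lp_norm_1 using has_bochner_integral_integral_eq[OF M] by (simp add: integral_completion)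
  have norm2: "Lp_norm 2 f = sqrt (D * n)"
    unfolding Lp_norm_2 using has_bochner_integral_integral_eq[OF N] by (simp add: integral_completion)

  \<comment> \<open>The inner integral for the pair of exponents p a and q a; bilinearity needs it
    for p and q in {2, 8}.\<close>
  define K where "K = (\<lambda>p q t. sqrt (pi / (p * a + q * a)) * exp (- (p * a * (q * a) / (p * a + q * a) + a) * t\<^sup>2))"
  have inner: "has_bochner_integral lborel (\<lambda>x. f x * f (x + t) * exp (- a * t\<^sup>2))
      ((K 2 2 t - 1 / 5 * K 2 8 t) - (1 / 5 * K 8 2 t - 1 / 25 * K 8 8 t))" for t
  proof -
    have "f x * f (x + t) * exp (- a * t\<^sup>2) =
      (exp (- (2 * a) * x\<^sup>2) * exp (- (2 * a) * (x + t)\<^sup>2) * exp (- a * t\<^sup>2)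
        - 1 / 5 * (exp (- (2 * a) * x\<^sup>2) * exp (- (8 * a) * (x + t)\<^sup>2) * exp (- a * t\<^sup>2)))
      - (1 / 5 * (exp (- (8 * a) * x\<^sup>2) * exp (- (2 * a) * (x + t)\<^sup>2) * exp (- a * t\<^sup>2))
        - 1 / 25 * (exp (- (8 * a) * x\<^sup>2) * exp (- (8 * a) * (x + t)\<^sup>2) * exp (- a * t\<^sup>2)))" for x
      unfolding f_def by (simp add: algebra_simps)
    then show ?thesis
      unfolding K_def using a
      by (simp only:) (intro has_bochner_integral_diff has_bochner_integral_mult_right
          has_bochner_integral_gaussian_pair; simp)
  qed
  have outer: "has_bochner_integral lborel (K p q) (D\<^sup>2 / sqrt (p * q + p + q))" if "p > 0" "q > 0" for p q
  proof -
    have "p * a * (q * a) + a * (p * a + q * a) = a\<^sup>2 * (p * q + p + q)"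
      by (simp add: power2_eq_square algebra_simps)
    then have "pi / sqrt (p * a * (q * a) + a * (p * a + q * a)) = D\<^sup>2 / sqrt (p * q + p + q)"
      using a D by (simp add: real_sqrt_mult)
    then show ?thesis
      unfolding K_def using has_bochner_integral_gaussian_pair_outer[of "p * a" "q * a" a] a that by simp
  qed
  define q :: real where "q = (1 / sqrt 8 - 2 / (5 * sqrt 26)) + 1 / (25 * sqrt 80)"
  have "has_bochner_integral lborel (\<lambda>t. (K 2 2 t - 1 / 5 * K 2 8 t) - (1 / 5 * K 8 2 t - 1 / 25 * K 8 8 t))
      ((D\<^sup>2 / sqrt (2 * 2 + 2 + 2) - 1 / 5 * (D\<^sup>2 / sqrt (2 * 8 + 2 + 8)))
        - (1 / 5 * (D\<^sup>2 / sqrt (8 * 2 + 8 + 2)) - 1 / 25 * (D\<^sup>2 / sqrt (8 * 8 + 8 + 8))))"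
    by (intro has_bochner_integral_diff has_bochner_integral_mult_right outer) auto
  also have "(D\<^sup>2 / sqrt (2 * 2 + 2 + 2) - 1 / 5 * (D\<^sup>2 / sqrt (2 * 8 + 2 + 8)))
        - (1 / 5 * (D\<^sup>2 / sqrt (8 * 2 + 8 + 2)) - 1 / 25 * (D\<^sup>2 / sqrt (8 * 8 + 8 + 8))) = D\<^sup>2 * q"
    by (simp add: q_def algebra_simps)
  finally have "(\<integral>t. (\<integral>x. f x * f (x + t) * exp (- a * t\<^sup>2) \<partial>lborel) \<partial>lborel) = D\<^sup>2 * q"
    unfolding has_bochner_integral_integral_eq[OF inner] by (rule has_bochner_integral_integral_eq)
  moreover have "(\<integral>t. (\<integral>x. f x * f (x + t) * exp (- a * t\<^sup>2) \<partial>lebesgue) \<partial>lebesgue)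
      = (\<integral>t. (\<integral>x. f x * f (x + t) * exp (- a * t\<^sup>2) \<partial>lborel) \<partial>lborel)"
    by (simp add: integral_completion)
  ultimately have Q: "(\<integral>t. (\<integral>x. f x * f (x + t) * exp (- a * t\<^sup>2) \<partial>lebesgue) \<partial>lebesgue) = D\<^sup>2 * q"
    by simp
  \<comment> \<open>Here 9/20 is 9 / (10 sqrt 2) from the L^1 norm times 1 / sqrt 2 from the
    constant. The margin is small, about 0.2787 against 0.2795, so each root is estimated to several
    digits.\<close>
  have "9 / 20 * sqrt n < q"
  proof -
    have "sqrt 8 \<le> 2.8285" "sqrt 80 \<le> 8.945" "sqrt 10 \<le> 3.163"
      by (rule real_le_lsqrt; simp add: power2_eq_square)+
    then have "1 / 2.8285 \<le> 1 / sqrt 8" "1 / (25 * 8.945) \<le> 1 / (25 * sqrt 80)"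
      and n: "2 / (5 * 3.163) \<le> 2 / (5 * sqrt 10)"
      by (intro divide_left_mono; simp)+
    moreover have "5.099 \<le> sqrt 26" by (rule real_le_rsqrt) (simp add: power2_eq_square)
    then have "2 / (5 * sqrt 26) \<le> 2 / (5 * 5.099)" by (intro divide_left_mono) auto
    moreover have "0.2795 < 1 / 2.8285 - 2 / (5 * 5.099) + 1 / (25 * 8.945 :: real)" by simp
    ultimately have q: "0.2795 < q" unfolding q_def by linarith
    have "n < 0.3836" using n unfolding n_def by (simp add: field_simps)
    then have "sqrt n < sqrt 0.3836" by simp
    also have "\<dots> \<le> 0.6194" by (rule real_le_lsqrt) (simp_all add: power2_eq_square)
    finally show ?thesis using q by simp
  qed
  then have less: "D * (9 / 20 * sqrt n) < D * q" using D by simp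
  have Da: "a / pi = (1 / D)\<^sup>2" using D a by (simp add: power_divide)
  have "(a / pi) powr (1/2) * (D\<^sup>2 * q) = D * q"
  proof -
    have "(a / pi) powr (1/2) = 1 / D"
      unfolding Da using D(1) by (subst powr_half_sqrt) (simp_all only: real_sqrt_abs, simp_all)
    then show ?thesis using D(1) by (simp add: power2_eq_square)
  qed
  moreover have "(a / (4 * pi)) powr (1/4) * (D * (9 / (10 * sqrt 2))) * sqrt (D * n) = D * (9 / 20 * sqrt n)"
  proof -
    have "a / (4 * pi) = (1 / (2 * D))\<^sup>2" using Da by (simp add: power_divide power_mult_distrib)
    then have c: "(a / (4 * pi)) powr (1/4) = 1 / (sqrt 2 * sqrt D)"
      using a D(1) by (simp add: powr_quarter real_sqrt_divide real_sqrt_mult)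
    show ?thesis unfolding c using D(1) by (simp add: real_sqrt_mult field_simps)
  qed
  ultimately show "(a / (4 * pi)) powr (1/4) * Lp_norm 1 f * Lp_norm 2 f
      < (a / pi) powr (1/2) *
        (\<integral>t. (\<integral>x. f x * f (x + t) * exp (- a * t\<^sup>2) \<partial>lebesgue) \<partial>lebesgue)"
    unfolding Q norm1 norm2 using less by (simp only:)
qed

theorem theorem1p2:
  fixes a :: real
  assumes "a > 0"
  shows "(\<forall>f \<in> Lp_space 1 \<inter> Lp_space 2.
            (a / pi) powr (1/2) *
              (\<integral>t. (\<integral>x. f x * f (x + t) * exp (- a * t\<^sup>2) \<partial>lebesgue) \<partial>lebesgue)
            \<le> (8 * a / (27 * pi)) powr (1/4) * Lp_norm 1 f * Lp_norm 2 f) \<and>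
         (\<exists>f \<in> Lp_space 1 \<inter> Lp_space 2.
            \<not> ((a / pi) powr (1/2) *
              (\<integral>t. (\<integral>x. f x * f (x + t) * exp (- a * t\<^sup>2) \<partial>lebesgue) \<partial>lebesgue)
            \<le> (a / (4 * pi)) powr (1/4) * Lp_norm 1 f * Lp_norm 2 f))"
proof (rule conjI)
  show "\<forall>f \<in> Lp_space 1 \<inter> Lp_space 2.
            (a / pi) powr (1/2) *
              (\<integral>t. (\<integral>x. f x * f (x + t) * exp (- a * t\<^sup>2) \<partial>lebesgue) \<partial>lebesgue)
            \<le> (8 * a / (27 * pi)) powr (1/4) * Lp_norm 1 f * Lp_norm 2 f"
    using gaussian_correlation_Lp_bound[OF assms] by blast
  show "\<exists>f \<in> Lp_space 1 \<inter> Lp_space 2.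
            \<not> ((a / pi) powr (1/2) *
              (\<integral>t. (\<integral>x. f x * f (x + t) * exp (- a * t\<^sup>2) \<partial>lebesgue) \<partial>lebesgue)
            \<le> (a / (4 * pi)) powr (1/4) * Lp_norm 1 f * Lp_norm 2 f)"
    unfolding not_le
    by (rule bexI[where x = "\<lambda>x. exp (- (2 * a) * x\<^sup>2) - 1 / 5 * exp (- (8 * a) * x\<^sup>2)"])
       (rule flattened_gaussian_exceeds[OF assms])+
qed

end
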